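(* Let $f:\mathbb S^1\times\mathbb R\to\mathbb R$ be smooth and let $F:B^1\to B^0$, $F(u)(t)=u'(t)+f(t,u(t))$. If $f$ is proper then the operator $F:B^1\to B^0$ is proper.
   Context: $\mathbb S^1=\mathbb R/\mathbb Z$. The pair $(B^1,B^0)$ is either $(H^1(\mathbb S^1;\mathbb R),L^2(\mathbb S^1;\mathbb R))$ or $(C^1(\mathbb S^1;\mathbb R),C^0(\mathbb S^1;\mathbb R))$; the result is asserted in both cases. A continuous map is proper if preimages of compact sets are compact. *)

theory Defs
  imports "HOL-Analysis.Analysis"
begin

section \<open>The circle\<close>

quotient_type circle = real / "\<lambda>x y. x - y \<in> \<int>"
  morphisms rep_circle to_circle
proof (rule equivpI)
  show "reflp (\<lambda>x y::real. x - y \<in> \<int>)"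
    by (simp add: reflp_def)
  show "symp (\<lambda>x y::real. x - y \<in> \<int>)"
    by (rule sympI) (metis Ints_minus minus_diff_eq)
  show "transp (\<lambda>x y::real. x - y \<in> \<int>)"
  proof (rule transpI)
    fix x y z :: real
    assume "x - y \<in> \<int>" "y - z \<in> \<int>"
    then have "(x - y) + (y - z) \<in> \<int>" by (rule Ints_add)
    then show "x - z \<in> \<int>" by simp
  qed
qed

instantiation circle :: topological_space
begin

text \<open>Quotient topology\<close>
definition open_circle :: "circle set \<Rightarrow> bool" where
  "open_circle U \<longleftrightarrow> open (to_circle -` U)"

instance
proof
  show "open (UNIV :: circle set)"
    by (simp add: open_circle_def)
  show "open (S \<inter> T)" if "open S" "open T" for S T :: "circle set"
    using that by (simp add: open_circle_def open_Int)
  show "open (\<Union>K)" if "\<forall>S\<in>K. open S" for K :: "circle set set"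
    using that by (auto simp: open_circle_def vimage_Union)
qed

end

lemma continuous_on_to_circle: "continuous_on UNIV to_circle"
  by (simp add: continuous_on_open_vimage open_circle_def)

definition circle_measure :: "circle measure" where
  "circle_measure = distr (restrict_space lborel {0..<1}) borel to_circle"

lemma emeasure_circle_measure:
  assumes "A \<in> sets borel"
  shows "emeasure circle_measure A = emeasure lborel (to_circle -` A \<inter> {0..<1})"
proof -
  have m: "to_circle \<in> borel_measurable (restrict_space lborel {0..<1})"
    using borel_measurable_continuous_onI[OF continuous_on_to_circle]
    by (auto intro: measurable_restrict_space1)
  have "emeasure circle_measure A =
      emeasure (restrict_space lborel {0..<1}) (to_circle -` A \<inter> {0..<1})"
    unfolding circle_measure_def by (subst emeasure_distr[OF m assms]) (simp add: space_restrict_space)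
  then show ?thesis
    by (simp add: emeasure_restrict_space)
qed

section \<open>Smooth maps and proper maps\<close>

text \<open>On a finite-dimensional space, \<open>g\<close> is of class \<open>C\<^sup>k\<^sup>+\<^sup>1\<close> iff it is differentiable
  and all its directional derivatives are of class \<open>C\<^sup>k\<close>.\<close>
primrec Ck_map :: "nat \<Rightarrow> ('a::euclidean_space \<Rightarrow> 'b::euclidean_space) \<Rightarrow> bool" where
  "Ck_map 0 g \<longleftrightarrow> continuous_on UNIV g"
| "Ck_map (Suc k) g \<longleftrightarrow>
     (\<forall>x. g differentiable (at x)) \<and> (\<forall>v. Ck_map k (\<lambda>x. frechet_derivative g (at x) v))"

definition smooth_map :: "('a::euclidean_space \<Rightarrow> 'b::euclidean_space) \<Rightarrow> bool" where
  "smooth_map g \<longleftrightarrow> (\<forall>k. Ck_map k g)"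

text \<open>The smooth structure of the circle is the one for which the covering map
  \<^const>\<open>to_circle\<close> is a local diffeomorphism.\<close>
definition smooth_on_circle :: "(circle \<Rightarrow> real) \<Rightarrow> bool" where
  "smooth_on_circle \<phi> \<longleftrightarrow> smooth_map (\<lambda>s. \<phi> (to_circle s))"

definition smooth_on_cylinder :: "(circle \<times> real \<Rightarrow> real) \<Rightarrow> bool" where
  "smooth_on_cylinder f \<longleftrightarrow> smooth_map (\<lambda>(s, x). f (to_circle s, x))"

definition has_circle_derivative :: "(circle \<Rightarrow> real) \<Rightarrow> (circle \<Rightarrow> real) \<Rightarrow> bool" where
  "has_circle_derivative u u' \<longleftrightarrow>
     (\<forall>s. ((\<lambda>r. u (to_circle r)) has_real_derivative u' (to_circle s)) (at s))"

definition proper :: "('a::topological_space \<Rightarrow> 'b::topological_space) \<Rightarrow> bool" where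
  "proper g \<longleftrightarrow> continuous_on UNIV g \<and> (\<forall>K. compact K \<longrightarrow> compact (g -` K))"

section \<open>The spaces of continuous and continuously differentiable functions\<close>

text \<open>As the circle is compact, all continuous functions on it are bounded, so that
  the library type of bounded continuous functions with the supremum norm is \<open>C\<^sup>0\<close>.\<close>
type_synonym C0_circle = "circle \<Rightarrow>\<^sub>C real"

typedef C1_circle =
  "{u :: C0_circle. \<exists>u' :: C0_circle. has_circle_derivative (apply_bcontfun u) (apply_bcontfun u')}"
  morphisms C1_to_C0 Abs_C1_circle
proof -
  have "has_circle_derivative (apply_bcontfun (0 :: C0_circle)) (apply_bcontfun (0 :: C0_circle))"
    by (simp add: has_circle_derivative_def)
  then show ?thesis by blast
qed

definition C1_deriv :: "C1_circle \<Rightarrow> C0_circle" where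
  "C1_deriv u =
     (THE u'. has_circle_derivative (apply_bcontfun (C1_to_C0 u)) (apply_bcontfun u'))"

lemma has_circle_derivative_C1_deriv:
  "has_circle_derivative (apply_bcontfun (C1_to_C0 u)) (apply_bcontfun (C1_deriv u))"
  unfolding C1_deriv_def
proof (rule theI')
  let ?P = "\<lambda>u'::C0_circle. has_circle_derivative (apply_bcontfun (C1_to_C0 u)) (apply_bcontfun u')"
  have "v = w" if "?P v" "?P w" for v w
  proof (rule bcontfun_eqI)
    fix t
    obtain s where "t = to_circle s"
      by (metis Quotient3_abs_rep Quotient3_circle)
    then show "apply_bcontfun v t = apply_bcontfun w t"
      using that DERIV_unique unfolding has_circle_derivative_def by blast
  qed
  then show "\<exists>!u'. ?P u'"
    using C1_to_C0[of u] by blast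
qed

instantiation C1_circle :: metric_space
begin

text \<open>The metric of the norm \<open>\<parallel>u\<parallel>\<^sub>\<infinity> + \<parallel>u'\<parallel>\<^sub>\<infinity>\<close>\<close>
definition dist_C1_circle :: "C1_circle \<Rightarrow> C1_circle \<Rightarrow> real" where
  "dist_C1_circle u v = dist (C1_to_C0 u) (C1_to_C0 v) + dist (C1_deriv u) (C1_deriv v)"

definition uniformity_C1_circle :: "(C1_circle \<times> C1_circle) filter" where
  "uniformity_C1_circle = (INF e\<in>{0<..}. principal {(x, y). dist x y < e})"

definition open_C1_circle :: "C1_circle set \<Rightarrow> bool" where
  "open_C1_circle U = (\<forall>x\<in>U. \<forall>\<^sub>F (x', y) in uniformity. x' = x \<longrightarrow> y \<in> U)"

instance
proof
  show "(dist u v = 0) = (u = v)" for u v :: C1_circle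
    by (auto simp: dist_C1_circle_def add_nonneg_eq_0_iff C1_to_C0_inject)
  show "dist u v \<le> dist u w + dist v w" for u v w :: C1_circle
    unfolding dist_C1_circle_def
    using dist_triangle2[of "C1_to_C0 u" "C1_to_C0 v" "C1_to_C0 w"]
      dist_triangle2[of "C1_deriv u" "C1_deriv v" "C1_deriv w"] by linarith
qed (simp_all only: uniformity_C1_circle_def open_C1_circle_def)

end

section \<open>The Lebesgue space and the Sobolev space\<close>

definition square_integrable :: "(circle \<Rightarrow> real) \<Rightarrow> bool" where
  "square_integrable u \<longleftrightarrow>
     u \<in> borel_measurable circle_measure \<and> integrable circle_measure (\<lambda>t. (u t)\<^sup>2)"

definition L2_rel :: "(circle \<Rightarrow> real) \<Rightarrow> (circle \<Rightarrow> real) \<Rightarrow> bool" where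
  "L2_rel u v \<longleftrightarrow>
     square_integrable u \<and> square_integrable v \<and> (AE t in circle_measure. u t = v t)"

quotient_type L2_circle = "circle \<Rightarrow> real" / partial: L2_rel
  morphisms rep_L2 to_L2
proof (rule part_equivpI)
  show "\<exists>u. L2_rel u u"
    by (rule exI[of _ "\<lambda>_. 0"]) (simp add: L2_rel_def square_integrable_def)
  show "symp L2_rel"
    by (rule sympI) (simp add: L2_rel_def eq_commute)
  show "transp L2_rel"
  proof (rule transpI)
    fix u v w
    assume h: "L2_rel u v" "L2_rel v w"
    have "AE t in circle_measure. u t = w t"
      using h[unfolded L2_rel_def, THEN conjunct2, THEN conjunct2] by eventually_elim simp
    then show "L2_rel u w"
      using h by (simp add: L2_rel_def)
  qed
qed

lemma square_integrable_mult:
  assumes "square_integrable u" "square_integrable v"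
  shows "integrable circle_measure (\<lambda>t. u t * v t)"
proof (rule Bochner_Integration.integrable_bound)
  show "integrable circle_measure (\<lambda>t. (u t)\<^sup>2 + (v t)\<^sup>2)"
    using assms by (simp add: square_integrable_def)
  show "(\<lambda>t. u t * v t) \<in> borel_measurable circle_measure"
    using assms by (auto simp: square_integrable_def)
  have "\<bar>a * b\<bar> \<le> a\<^sup>2 + b\<^sup>2" for a b :: real
  proof -
    have "2 * (\<bar>a\<bar> * \<bar>b\<bar>) \<le> a\<^sup>2 + b\<^sup>2"
      using sum_squares_bound[of "\<bar>a\<bar>" "\<bar>b\<bar>"] by (simp add: mult.assoc)
    moreover have "0 \<le> \<bar>a\<bar> * \<bar>b\<bar>" by simp
    ultimately show ?thesis unfolding abs_mult by linarith
  qed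
  then show "AE t in circle_measure. norm (u t * v t) \<le> norm ((u t)\<^sup>2 + (v t)\<^sup>2)"
    by simp
qed

lemma square_integrable_diff:
  assumes "square_integrable u" "square_integrable v"
  shows "square_integrable (\<lambda>t. u t - v t)"
  using assms square_integrable_mult[OF assms]
  by (auto simp: square_integrable_def power2_diff mult.assoc)

lemma L2_Cauchy_Schwarz:
  assumes "square_integrable u" "square_integrable v"
  shows "(LINT t|circle_measure. u t * v t)
    \<le> sqrt (LINT t|circle_measure. (u t)\<^sup>2) * sqrt (LINT t|circle_measure. (v t)\<^sup>2)"
proof -
  define a where "a = (LINT t|circle_measure. (u t)\<^sup>2)"
  define b where "b = (LINT t|circle_measure. (v t)\<^sup>2)"
  define c where "c = (LINT t|circle_measure. u t * v t)"
  have i: "integrable circle_measure (\<lambda>t. (u t)\<^sup>2)" "integrable circle_measure (\<lambda>t. (v t)\<^sup>2)"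
    "integrable circle_measure (\<lambda>t. u t * v t)"
    using assms square_integrable_mult[OF assms] by (auto simp: square_integrable_def)
  have nn: "a \<ge> 0" "b \<ge> 0" by (simp_all add: a_def b_def)
  have q: "0 \<le> a * x\<^sup>2 - 2 * c * x * y + b * y\<^sup>2" for x y
  proof -
    have "0 \<le> (LINT t|circle_measure. (x * u t - y * v t)\<^sup>2)" by simp
    also have "\<dots> = (LINT t|circle_measure. x\<^sup>2 * (u t)\<^sup>2 - 2 * x * y * (u t * v t) + y\<^sup>2 * (v t)\<^sup>2)"
      by (rule Bochner_Integration.integral_cong) (auto simp: power2_eq_square algebra_simps)
    also have "\<dots> = x\<^sup>2 * a - 2 * x * y * c + y\<^sup>2 * b"
      using i by (simp add: a_def b_def c_def)
    finally show ?thesis by (simp add: algebra_simps)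
  qed
  have "c\<^sup>2 \<le> a * b"
  proof (cases "b = 0")
    case False
    then have "0 \<le> b * (a * b - c\<^sup>2)"
      using q[of b c] by (simp add: power2_eq_square algebra_simps)
    then show ?thesis using nn False by (simp add: zero_le_mult_iff)
  next
    case True
    have "c = 0"
    proof (rule ccontr)
      assume "c \<noteq> 0"
      have "0 \<le> a - 2 * c * ((a + 1) / (2 * c))" using q[of 1 "(a + 1) / (2 * c)"] True by simp
      then show False using \<open>c \<noteq> 0\<close> by simp
    qed
    then show ?thesis using True by simp
  qed
  then have "c \<le> sqrt (a * b)" by (rule real_le_rsqrt)
  then show ?thesis by (simp add: a_def b_def c_def real_sqrt_mult)
qed

instantiation L2_circle :: metric_space
begin

lift_definition dist_L2_circle :: "L2_circle \<Rightarrow> L2_circle \<Rightarrow> real"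
  is "\<lambda>u v. sqrt (LINT t|circle_measure. (u t - v t)\<^sup>2)"
proof -
  fix u u' v v'
  assume h: "L2_rel u u'" "L2_rel v v'"
  have "(LINT t|circle_measure. (u t - v t)\<^sup>2) = (LINT t|circle_measure. (u' t - v' t)\<^sup>2)"
  proof (rule integral_cong_AE)
    show "AE t in circle_measure. (u t - v t)\<^sup>2 = (u' t - v' t)\<^sup>2"
      using h[unfolded L2_rel_def, THEN conjunct2, THEN conjunct2] by eventually_elim simp
  qed (use h in \<open>auto simp: L2_rel_def square_integrable_def\<close>)
  then show "sqrt (LINT t|circle_measure. (u t - v t)\<^sup>2) = sqrt (LINT t|circle_measure. (u' t - v' t)\<^sup>2)"
    by simp
qed

definition uniformity_L2_circle :: "(L2_circle \<times> L2_circle) filter" where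
  "uniformity_L2_circle = (INF e\<in>{0<..}. principal {(x, y). dist x y < e})"

definition open_L2_circle :: "L2_circle set \<Rightarrow> bool" where
  "open_L2_circle U = (\<forall>x\<in>U. \<forall>\<^sub>F (x', y) in uniformity. x' = x \<longrightarrow> y \<in> U)"

instance
proof
  show "(dist u v = 0) = (u = v)" for u v :: L2_circle
  proof transfer
    fix u v
    assume "L2_rel u u" "L2_rel v v"
    then have h: "square_integrable u" "square_integrable v" by (auto simp: L2_rel_def)
    then have "integrable circle_measure (\<lambda>t. (u t - v t)\<^sup>2)"
      using square_integrable_diff[OF h] by (simp add: square_integrable_def)
    then have "(LINT t|circle_measure. (u t - v t)\<^sup>2) = 0
        \<longleftrightarrow> (AE t in circle_measure. (u t - v t)\<^sup>2 = 0)"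
      by (rule integral_nonneg_eq_0_iff_AE) simp
    then show "(sqrt (LINT t|circle_measure. (u t - v t)\<^sup>2) = 0) = L2_rel u v"
      using h by (simp add: L2_rel_def)
  qed
  show "dist u v \<le> dist u w + dist v w" for u v w :: L2_circle
  proof transfer
    fix u v w
    assume "L2_rel u u" "L2_rel v v" "L2_rel w w"
    then have h: "square_integrable (\<lambda>t. u t - w t)" "square_integrable (\<lambda>t. w t - v t)"
      by (auto simp: L2_rel_def intro: square_integrable_diff)
    define a where "a = (LINT t|circle_measure. (u t - w t)\<^sup>2)"
    define b where "b = (LINT t|circle_measure. (w t - v t)\<^sup>2)"
    have nn: "a \<ge> 0" "b \<ge> 0" by (simp_all add: a_def b_def)
    have "(LINT t|circle_measure. (u t - v t)\<^sup>2) =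
      (LINT t|circle_measure. (u t - w t)\<^sup>2 + 2 * ((u t - w t) * (w t - v t)) + (w t - v t)\<^sup>2)"
      by (rule Bochner_Integration.integral_cong) (auto simp: power2_eq_square algebra_simps)
    also have "\<dots> = a + 2 * (LINT t|circle_measure. (u t - w t) * (w t - v t)) + b"
      using h square_integrable_mult[OF h] by (simp add: square_integrable_def a_def b_def)
    also have "\<dots> \<le> a + 2 * (sqrt a * sqrt b) + b"
      using L2_Cauchy_Schwarz[OF h] by (simp add: a_def b_def)
    also have "\<dots> = (sqrt a + sqrt b)\<^sup>2"
      using nn by (simp add: power2_sum algebra_simps)
    finally have "sqrt (LINT t|circle_measure. (u t - v t)\<^sup>2) \<le> sqrt a + sqrt b"
      using nn by (intro real_le_lsqrt) auto
    moreover have "b = (LINT t|circle_measure. (v t - w t)\<^sup>2)"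
      by (simp add: b_def power2_commute)
    ultimately show "sqrt (LINT t|circle_measure. (u t - v t)\<^sup>2) \<le>
        sqrt (LINT t|circle_measure. (u t - w t)\<^sup>2) + sqrt (LINT t|circle_measure. (v t - w t)\<^sup>2)"
      by (simp add: a_def)
  qed
qed (simp_all only: uniformity_L2_circle_def open_L2_circle_def)

end

definition has_weak_derivative :: "L2_circle \<Rightarrow> L2_circle \<Rightarrow> bool" where
  "has_weak_derivative u u' \<longleftrightarrow>
     (\<forall>\<phi> \<phi>'. smooth_on_circle \<phi> \<longrightarrow> has_circle_derivative \<phi> \<phi>' \<longrightarrow>
       (LINT t|circle_measure. rep_L2 u t * \<phi>' t) = - (LINT t|circle_measure. rep_L2 u' t * \<phi> t))"

typedef H1_circle = "{u :: L2_circle. \<exists>u'. has_weak_derivative u u'}"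
  morphisms H1_to_L2 Abs_H1_circle
proof -
  have z: "L2_rel (\<lambda>_. 0) (\<lambda>_. 0)"
    by (simp add: L2_rel_def square_integrable_def)
  then have "L2_rel (rep_L2 (to_L2 (\<lambda>_. 0))) (\<lambda>_. 0)"
    by (rule rep_abs_rsp_left[OF Quotient3_L2_circle])
  then have ae: "AE t in circle_measure. rep_L2 (to_L2 (\<lambda>_. 0)) t = 0"
    by (simp add: L2_rel_def)
  have "(LINT t|circle_measure. rep_L2 (to_L2 (\<lambda>_. 0)) t * \<psi> t) = 0" for \<psi>
    by (rule integral_eq_zero_AE) (use ae in auto)
  then have "has_weak_derivative (to_L2 (\<lambda>_. 0)) (to_L2 (\<lambda>_. 0))"
    by (simp add: has_weak_derivative_def)
  then show ?thesis by blast
qed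

text \<open>The weak derivative is unique as an element of \<^typ>\<open>L2_circle\<close>.\<close>
definition H1_deriv :: "H1_circle \<Rightarrow> L2_circle" where
  "H1_deriv u = (SOME u'. has_weak_derivative (H1_to_L2 u) u')"

lemma has_weak_derivative_H1_deriv: "has_weak_derivative (H1_to_L2 u) (H1_deriv u)"
  unfolding H1_deriv_def using H1_to_L2[of u] by (auto intro: someI_ex)

instantiation H1_circle :: metric_space
begin

text \<open>The metric of the norm \<open>\<parallel>u\<parallel>\<^sub>H\<^sub>1 = (\<parallel>u\<parallel>\<^sub>2\<^sup>2 + \<parallel>u'\<parallel>\<^sub>2\<^sup>2)\<^sup>1\<^sup>/\<^sup>2\<close>\<close>
definition dist_H1_circle :: "H1_circle \<Rightarrow> H1_circle \<Rightarrow> real" where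
  "dist_H1_circle u v =
     sqrt ((dist (H1_to_L2 u) (H1_to_L2 v))\<^sup>2 + (dist (H1_deriv u) (H1_deriv v))\<^sup>2)"

definition uniformity_H1_circle :: "(H1_circle \<times> H1_circle) filter" where
  "uniformity_H1_circle = (INF e\<in>{0<..}. principal {(x, y). dist x y < e})"

definition open_H1_circle :: "H1_circle set \<Rightarrow> bool" where
  "open_H1_circle U = (\<forall>x\<in>U. \<forall>\<^sub>F (x', y) in uniformity. x' = x \<longrightarrow> y \<in> U)"

instance
proof
  have eq: "dist u v = dist (H1_to_L2 u, H1_deriv u) (H1_to_L2 v, H1_deriv v)" for u v :: H1_circle
    by (simp add: dist_H1_circle_def dist_Pair_Pair)
  show "(dist u v = 0) = (u = v)" for u v :: H1_circle
    by (auto simp: eq H1_to_L2_inject)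
  show "dist u v \<le> dist u w + dist v w" for u v w :: H1_circle
    unfolding eq by (rule dist_triangle2)
qed (simp_all only: uniformity_H1_circle_def open_H1_circle_def)

end

section \<open>The operator\<close>

text \<open>\<^const>\<open>Bcontfun\<close> and \<^const>\<open>to_L2\<close> are meaningful only for arguments that are bounded and
  continuous, respectively square integrable. For smooth \<open>f\<close> they are, in the Sobolev
  case because functions in \<open>H\<^sup>1\<close> are essentially bounded. The choice of the
  representatives \<^const>\<open>rep_L2\<close> does not affect the value of \<open>F_H\<close>.\<close>

definition F_C :: "(circle \<times> real \<Rightarrow> real) \<Rightarrow> C1_circle \<Rightarrow> C0_circle" where
  "F_C f u = Bcontfun (\<lambda>t. apply_bcontfun (C1_deriv u) t + f (t, apply_bcontfun (C1_to_C0 u) t))"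

definition F_H :: "(circle \<times> real \<Rightarrow> real) \<Rightarrow> H1_circle \<Rightarrow> L2_circle" where
  "F_H f u = to_L2 (\<lambda>t. rep_L2 (H1_deriv u) t + f (t, rep_L2 (H1_to_L2 u) t))"

end

theory Submission
  imports Defs "HOL-Complex_Analysis.Great_Picard"
begin

text \<open>
  In both cases \<open>u\<close> is a continuous function on the circle and \<open>u' = g - f(t, u)\<close> is read as the
  integrated equation, with \<open>g = F(u)\<close> merely in \<open>L\<^sup>1\<close>. Suppose that the norm of \<open>g\<close> in \<open>L\<^sup>1\<close>
  is at most \<open>M\<close>. As \<open>f\<close> is proper, \<open>\<bar>f\<bar> \<ge> M + 1\<close> where \<open>\<bar>x\<bar> \<ge> R\<close>, and \<open>f\<close> has a
  constant sign on each of the two strips \<open>x \<ge> R\<close> and \<open>x \<le> -R\<close>. So \<open>u\<close> cannot stay above \<open>R\<close>, and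
  starting at a time with \<open>u \<le> R\<close>, running forward if \<open>f > 0\<close> on the upper strip and backward if \<open>f < 0\<close>,
  it never exceeds \<open>R + M\<close>; the same holds below. If now \<open>F(u\<^sub>n)\<close> converges, then \<open>u\<^sub>n\<close> minus
  a primitive of \<open>F(u\<^sub>n)\<close> is bounded and uniformly Lipschitz, so by Arzela-Ascoli a subsequence of
  \<open>u\<^sub>n\<close> converges uniformly, and \<open>u\<^sub>n' = F(u\<^sub>n) - f(t, u\<^sub>n)\<close> converges in \<open>B\<^sup>0\<close>.

  For \<open>B\<^sup>1 = H\<^sup>1\<close> the continuous representative comes from the lemma of du Bois-Reymond: \<open>u\<close> minus
  a primitive of its weak derivative is, up to a constant, orthogonal to all smooth functions, which are
  dense by Stone-Weierstrass.
\<close>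

section \<open>The topology of the circle\<close>

lemma to_circle_eq_iff: "to_circle s = to_circle r \<longleftrightarrow> s - r \<in> \<int>"
  by (rule circle.abs_eq_iff)

lemma to_circle_add_int: "to_circle (s + of_int n) = to_circle s"
  by (simp add: to_circle_eq_iff)

lemma to_circle_unit_interval:
  obtains s where "s \<in> {0..<1}" "t = to_circle s"
proof -
  obtain r where r: "t = to_circle r"
    by (metis Quotient3_abs_rep Quotient3_circle)
  have "to_circle (frac r) = t"
    unfolding r to_circle_eq_iff frac_def by simp
  then show thesis
    using that[of "frac r"] by (simp add: frac_lt_1)
qed

lemma to_circle_1: "to_circle 1 = to_circle 0"
  by (simp add: to_circle_eq_iff)

lemma to_circle_image_unit_interval: "to_circle ` {0..1} = UNIV"
proof -
  have "t \<in> to_circle ` {0..1}" for t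
    by (rule to_circle_unit_interval[of t]) auto
  then show ?thesis by auto
qed

text \<open>The preimage of the image is the union of the integer translates of \<open>U\<close>,
  each of them open. Openness of the projection carries a countable basis of the line over to the
  circle.\<close>

lemma open_to_circle_image:
  assumes "open U"
  shows "open (to_circle ` U)"
proof -
  have "to_circle -` to_circle ` U = (\<Union>n::int. (\<lambda>x. x + of_int n) -` U)"
  proof (intro set_eqI iffI)
    fix x assume "x \<in> to_circle -` to_circle ` U"
    then obtain y where y: "y \<in> U" "y - x \<in> \<int>"
      by (metis to_circle_eq_iff imageE vimageE)
    then obtain n where "y - x = of_int n" by (auto elim: Ints_cases)
    then have "x + of_int n = y" by simp
    then show "x \<in> (\<Union>n::int. (\<lambda>x. x + of_int n) -` U)" using y by auto
  next
    fix x assume "x \<in> (\<Union>n::int. (\<lambda>x. x + of_int n) -` U)"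
    then obtain n :: int where "x + of_int n \<in> U" by auto
    then have "to_circle (x + of_int n) \<in> to_circle ` U" by (rule imageI)
    then show "x \<in> to_circle -` to_circle ` U"
      by (simp add: to_circle_add_int)
  qed
  moreover have "open \<dots>"
    by (intro open_UN ballI open_vimage assms continuous_intros)
  ultimately show ?thesis by (simp add: open_circle_def)
qed

lemma continuous_on_circle_iff:
  fixes g :: "circle \<Rightarrow> 'b::topological_space"
  shows "continuous_on UNIV g \<longleftrightarrow> continuous_on UNIV (\<lambda>s. g (to_circle s))"
  by (simp add: continuous_on_open_vimage open_circle_def vimage_def)

text \<open>The standard embedding as the unit circle of the complex plane. The arbitrary
  representative \<open>rep_circle t\<close> does no harm because \<open>cis\<close> has period 2
  pi. The embedding yields the Hausdorff property, and its real and imaginary parts serve as smooth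
  functions that separate points.\<close>

definition circle_cis :: "circle \<Rightarrow> complex" where
  "circle_cis t = cis (2 * pi * rep_circle t)"

lemma circle_cis_to_circle: "circle_cis (to_circle s) = cis (2 * pi * s)"
proof -
  have "to_circle (rep_circle (to_circle s)) = to_circle s"
    by (metis Quotient3_abs_rep Quotient3_circle)
  then obtain n where "rep_circle (to_circle s) - s = of_int n"
    by (auto simp: to_circle_eq_iff elim: Ints_cases)
  then have n: "rep_circle (to_circle s) = s + of_int n" by simp
  have 1: "cis (2 * pi * of_int n) = 1"
    by (rule cis_multiple_2pi) simp
  have "cis (2 * pi * s + 2 * pi * of_int n) = cis (2 * pi * s) * cis (2 * pi * of_int n)"
    by (rule cis_mult[symmetric])
  then have "cis (2 * pi * s + 2 * pi * of_int n) = cis (2 * pi * s)"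
    unfolding 1 by simp
  then show ?thesis
    by (simp only: circle_cis_def n distrib_left)
qed

lemma continuous_circle_cis: "continuous_on UNIV circle_cis"
  unfolding continuous_on_circle_iff circle_cis_to_circle by (intro continuous_intros)

lemma inj_circle_cis: "inj circle_cis"
proof (rule injI)
  fix x y assume eq: "circle_cis x = circle_cis y"
  obtain s r where s: "x = to_circle s" and r: "y = to_circle r"
    by (meson to_circle_unit_interval)
  have "cis (2 * pi * s - 2 * pi * r) = 1"
    using eq unfolding s r circle_cis_to_circle by (simp flip: cis_divide)
  then have "cos (2 * pi * s - 2 * pi * r) = 1"
    by (metis cis.sel(1) one_complex.sel(1))
  then obtain n :: int where "2 * pi * s - 2 * pi * r = of_int n * 2 * pi"
    by (auto simp: cos_one_2pi_int)
  then have "2 * pi * (s - r) = 2 * pi * of_int n" by (simp add: algebra_simps)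
  then have "s - r = of_int n" by simp
  then show "x = y" by (simp add: s r to_circle_eq_iff)
qed

text \<open>Disjoint neighbourhoods in the complex plane are pulled back along the injective
  continuous map \<open>circle_cis\<close>.\<close>

instance circle :: t2_space
proof
  fix x y :: circle assume "x \<noteq> y"
  then have "circle_cis x \<noteq> circle_cis y"
    using inj_circle_cis by (auto dest: injD)
  then obtain U V where UV: "open U" "open V" "circle_cis x \<in> U" "circle_cis y \<in> V" "U \<inter> V = {}"
    by (rule separation_t2[THEN iffD1, elim_format]) blast
  have "open (circle_cis -` U)" "open (circle_cis -` V)"
    using UV(1,2) continuous_circle_cis by (simp_all add: open_vimage)
  moreover have "x \<in> circle_cis -` U" "y \<in> circle_cis -` V" "circle_cis -` U \<inter> circle_cis -` V = {}"
    using UV(3-5) by auto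
  ultimately show "\<exists>U V. open U \<and> open V \<and> x \<in> U \<and> y \<in> V \<and> U \<inter> V = {}"
    by blast
qed

text \<open>Second countability makes pairing into \<open>circle \<times> real\<close> Borel
  measurable, on which the measurability of \<open>t\<close> mapped to \<open>f (t, u t)\<close> for
  measurable \<open>u\<close> rests.\<close>

instance circle :: second_countable_topology
proof
  obtain B :: "real set set" where B: "countable B" "topological_basis B"
    using ex_countable_basis by blast
  have "topological_basis ((`) to_circle ` B)"
  proof (rule topological_basisI)
    show "open B'" if "B' \<in> (`) to_circle ` B" for B'
      using that open_to_circle_image topological_basis_open[OF B(2)] by auto
    fix U :: "circle set" and x assume U: "open U" "x \<in> U"
    obtain s where s: "x = to_circle s" by (meson to_circle_unit_interval)
    have "open (to_circle -` U)" "s \<in> to_circle -` U"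
      using U s by (auto simp: open_circle_def)
    then obtain b where "b \<in> B" "s \<in> b" "b \<subseteq> to_circle -` U"
      using topological_basisE[OF B(2)] by blast
    then show "\<exists>B'\<in>(`) to_circle ` B. x \<in> B' \<and> B' \<subseteq> U"
      using s by blast
  qed
  then show "\<exists>B :: circle set set. countable B \<and> open = generate_topology B"
    using B(1) by (metis countable_image topological_basis_imp_subbasis)
qed

lemma compact_circle: "compact (UNIV :: circle set)"
proof -
  have "compact (to_circle ` {0..1})"
    by (intro compact_continuous_image continuous_on_subset[OF continuous_on_to_circle]) auto
  then show ?thesis by (simp only: to_circle_image_unit_interval)
qed

lemma continuous_bcontfun_circle:
  fixes g :: "circle \<Rightarrow> real"
  assumes "continuous_on UNIV g"
  shows "g \<in> bcontfun"
  using assms compact_imp_bounded[OF compact_continuous_image[OF assms compact_circle]]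
  by (auto simp: bcontfun_def)

text \<open>The map from the unit interval onto the circle is closed (compact to Hausdorff), hence a quotient map.\<close>
lemma descend_to_circle:
  fixes p :: "real \<Rightarrow> real"
  assumes p: "continuous_on {0..1} p" and p01: "p 0 = p 1"
  obtains u :: C0_circle where "\<And>s. s \<in> {0..1} \<Longrightarrow> apply_bcontfun u (to_circle s) = p s"
proof -
  define g where "g t = p (SOME s. s \<in> {0..1} \<and> t = to_circle s)" for t
  have g: "g (to_circle s) = p s" if s: "s \<in> {0..1}" for s
  proof -
    define r where "r = (SOME r. r \<in> {0..1} \<and> to_circle s = to_circle r)"
    have "r \<in> {0..1} \<and> to_circle s = to_circle r"
      unfolding r_def by (rule someI[of _ s]) (use s in auto)
    then have r: "r \<in> {0..1}" "s - r \<in> \<int>" by (auto simp: to_circle_eq_iff)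
    then obtain n where n: "s - r = of_int n" by (auto elim: Ints_cases)
    \<comment> \<open>Points of the unit interval that differ by an integer are equal or are the two
      endpoints, where \<open>p\<close> agrees by \<open>p01\<close>.\<close>
    have "-1 \<le> n" "n \<le> 1" using n r(1) s by auto
    then have "n = -1 \<or> n = 0 \<or> n = 1" by auto
    then have "r = s \<or> (r = 1 \<and> s = 0) \<or> (r = 0 \<and> s = 1)"
      using n r(1) s by auto
    then have "p r = p s" using p01 by auto
    then show ?thesis by (simp add: g_def r_def)
  qed
  have "continuous_on UNIV g"
    unfolding continuous_on_closed_vimage[OF closed_UNIV]
  proof (intro allI impI)
    fix C :: "real set" assume C: "closed C"
    have eq: "g -` C \<inter> UNIV = to_circle ` ({0..1} \<inter> p -` C)"
    proof (intro set_eqI iffI)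
      fix t assume t: "t \<in> g -` C \<inter> UNIV"
      show "t \<in> to_circle ` ({0..1} \<inter> p -` C)"
        by (rule to_circle_unit_interval[of t]) (use t g in force)
    qed (use g in auto)
    have "closed (p -` C \<inter> {0..1})"
      using p C continuous_on_closed_vimage[of "{0..1}" p] by auto
    then have "compact ({0..1} \<inter> ({0..1} \<inter> p -` C))"
      by (intro compact_Int_closed) (auto simp: Int_commute)
    then have "compact (to_circle ` ({0..1} \<inter> p -` C))"
      by (intro compact_continuous_image continuous_on_subset[OF continuous_on_to_circle]) auto
    then show "closed (g -` C \<inter> UNIV)" unfolding eq by (rule compact_imp_closed)
  qed
  then have "apply_bcontfun (Bcontfun g) = g"
    by (intro Bcontfun_inverse continuous_bcontfun_circle)
  then show thesis using that[of "Bcontfun g"] g by simp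
qed

section \<open>Measure and integration on the circle\<close>

lemma to_circle_measurable [measurable]: "to_circle \<in> borel_measurable borel"
  by (rule borel_measurable_continuous_onI[OF continuous_on_to_circle])

lemma sets_circle_measure [measurable_cong, simp]: "sets circle_measure = sets borel"
  and space_circle_measure [simp]: "space circle_measure = UNIV"
  by (simp_all add: circle_measure_def)

lemma borel_measurable_circle_iff [simp]:
  "borel_measurable circle_measure = borel_measurable borel"
  by (rule measurable_cong_sets) simp_all

lemma emeasure_circle_UNIV: "emeasure circle_measure UNIV = 1"
proof -
  have "to_circle -` UNIV \<inter> {0..<1} = {0..<1::real}" by simp
  then show ?thesis by (simp add: emeasure_circle_measure)
qed

interpretation circle: finite_measure circle_measure
  by standard (simp add: emeasure_circle_UNIV)

lemma measure_circle_UNIV [simp]: "measure circle_measure UNIV = 1"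
  by (simp add: measure_def emeasure_circle_UNIV)

lemma integrable_circle_measure_iff:
  fixes g :: "circle \<Rightarrow> real"
  assumes [measurable]: "g \<in> borel_measurable borel"
  shows "integrable circle_measure g \<longleftrightarrow> set_integrable lborel {0..<1} (\<lambda>s. g (to_circle s))"
    and "(LINT t|circle_measure. g t) = (LINT s:{0..<1}|lborel. g (to_circle s))"
proof -
  have m: "to_circle \<in> borel_measurable (restrict_space lborel {0..<1})"
    by (rule measurable_restrict_space1) simp
  show "integrable circle_measure g \<longleftrightarrow> set_integrable lborel {0..<1} (\<lambda>s. g (to_circle s))"
    unfolding circle_measure_def set_integrable_def
    by (subst integrable_distr_eq[OF m]) (simp_all add: integrable_restrict_space)
  show "(LINT t|circle_measure. g t) = (LINT s:{0..<1}|lborel. g (to_circle s))"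
    unfolding circle_measure_def set_lebesgue_integral_def
    by (subst integral_distr[OF m]) (simp_all add: integral_restrict_space)
qed

text \<open>The passage from the Bochner integral on the circle to the gauge integral on the line.
  The measure lives on \<open>{0..<1}\<close>, and the added endpoint 1 is negligible.\<close>

lemma
  fixes g :: "circle \<Rightarrow> real"
  assumes "integrable circle_measure g"
  shows circle_absolutely_integrable: "(\<lambda>s. g (to_circle s)) absolutely_integrable_on {0..1}"
    and circle_integral_eq: "(LINT t|circle_measure. g t) = integral {0..1} (\<lambda>s. g (to_circle s))"
proof -
  have half_open: "(f has_integral y) {0..<1} \<longleftrightarrow> (f has_integral y) {0..1}" for f :: "real \<Rightarrow> real" and y
  proof (rule has_integral_spike_set_eq)
    show "negligible {x \<in> {0..<1} - {0..1}. f x \<noteq> 0}"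
      by (rule negligible_subset[of "{}"]) auto
    show "negligible {x \<in> {0..1} - {0..<1}. f x \<noteq> 0}"
      by (rule negligible_subset[of "{1}"]) auto
  qed
  have [measurable]: "g \<in> borel_measurable borel" using assms by auto
  have i: "set_integrable lborel {0..<1} (\<lambda>s. g (to_circle s))"
    using assms by (simp add: integrable_circle_measure_iff)
  \<comment> \<open>Absolute integrability for the gauge integral asks for the function and its
    absolute value separately.\<close>
  have "integrable circle_measure (\<lambda>t. \<bar>g t\<bar>)" using assms by simp
  then have ai: "set_integrable lborel {0..<1} (\<lambda>s. \<bar>g (to_circle s)\<bar>)"
    by (subst (asm) integrable_circle_measure_iff) simp_all
  note r = set_borel_integral_eq_integral[OF i] set_borel_integral_eq_integral[OF ai]
  show "(\<lambda>s. g (to_circle s)) absolutely_integrable_on {0..1}"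
    using r(1,3) unfolding absolutely_integrable_on_def integrable_on_def half_open by simp
  have "((\<lambda>s. g (to_circle s)) has_integral (LINT t|circle_measure. g t)) {0..1}"
    using r(1,2) unfolding integrable_circle_measure_iff(2)[OF \<open>g \<in> _\<close>]
    by (simp add: has_integral_integral flip: half_open)
  then show "(LINT t|circle_measure. g t) = integral {0..1} (\<lambda>s. g (to_circle s))"
    by (simp add: integral_unique)
qed

lemma continuous_circle_bounded:
  fixes g :: "circle \<Rightarrow> real"
  assumes "continuous_on UNIV g"
  obtains B where "\<And>t. \<bar>g t\<bar> \<le> B"
proof -
  have "bounded (range g)"
    by (rule compact_imp_bounded[OF compact_continuous_image[OF assms compact_circle]])
  then show thesis using that by (auto simp: bounded_iff)
qed

lemma integrable_mult_continuous:
  fixes g :: "circle \<Rightarrow> real"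
  assumes "integrable circle_measure w" "continuous_on UNIV g"
  shows "integrable circle_measure (\<lambda>t. w t * g t)"
proof -
  obtain B where B: "\<And>t. \<bar>g t\<bar> \<le> B" using continuous_circle_bounded[OF assms(2)] by blast
  have [measurable]: "g \<in> borel_measurable borel"
    by (rule borel_measurable_continuous_onI[OF assms(2)])
  have [measurable]: "w \<in> borel_measurable borel" using assms(1) by auto
  show ?thesis
  proof (rule Bochner_Integration.integrable_bound)
    show "integrable circle_measure (\<lambda>t. B * w t)" using assms(1) by simp
    have "\<bar>w t * g t\<bar> \<le> \<bar>B * w t\<bar>" for t
    proof -
      have "\<bar>g t\<bar> * \<bar>w t\<bar> \<le> \<bar>B\<bar> * \<bar>w t\<bar>"
        using B[of t] by (intro mult_right_mono) auto
      then show ?thesis by (simp add: abs_mult mult.commute)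
    qed
    then show "AE t in circle_measure. norm (w t * g t) \<le> norm (B * w t)" by simp
  qed simp
qed

lemma integrable_continuous_circle:
  fixes g :: "circle \<Rightarrow> real"
  assumes "continuous_on UNIV g"
  shows "integrable circle_measure g"
  using integrable_mult_continuous[OF _ assms, of "\<lambda>_. 1"] by simp

section \<open>Smooth functions on the circle\<close>

text \<open>On the line a directional derivative is the ordinary derivative times the direction
  \<open>c\<close>; this closure property handles all directions at once in
  \<open>Ck_map_Suc_iff\<close>.\<close>

lemma Ck_map_cmult:
  fixes g :: "real \<Rightarrow> real"
  shows "Ck_map k g \<Longrightarrow> Ck_map k (\<lambda>x. g x * c)"
proof (induction k arbitrary: g)
  case 0
  then show ?case by (auto intro: continuous_intros)
next
  case (Suc k)
  have d: "((\<lambda>x. g x * c) has_derivative (\<lambda>v. frechet_derivative g (at x) v * c)) (at x)" for x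
    using Suc.prems by (intro has_derivative_mult_left) (simp add: frechet_derivative_works)
  have "frechet_derivative (\<lambda>x. g x * c) (at x) = (\<lambda>v. frechet_derivative g (at x) v * c)" for x
    using frechet_derivative_at[OF d] by simp
  then show ?case
    using d Suc by (auto simp: differentiable_def)
qed

text \<open>A linear map on the line is multiplication by its value at 1, so the quantifier over
  directions collapses. This form drives the inductions on \<open>k\<close> below.\<close>

lemma Ck_map_Suc_iff:
  fixes g :: "real \<Rightarrow> real"
  shows "Ck_map (Suc k) g \<longleftrightarrow> (\<exists>g'. (\<forall>x. (g has_real_derivative g' x) (at x)) \<and> Ck_map k g')"
proof
  assume g: "Ck_map (Suc k) g"
  have "(g has_real_derivative frechet_derivative g (at x) 1) (at x)" for x
  proof -
    have d: "(g has_derivative frechet_derivative g (at x)) (at x)"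
      using g by (simp add: frechet_derivative_works)
    have "frechet_derivative g (at x) v = frechet_derivative g (at x) 1 * v" for v
      using linear_cmul[OF has_derivative_linear[OF d], of v 1] by simp
    then show ?thesis
      using d by (metis (no_types, lifting) ext has_field_derivative_def)
  qed
  then show "\<exists>g'. (\<forall>x. (g has_real_derivative g' x) (at x)) \<and> Ck_map k g'"
    using g by (intro exI[of _ "\<lambda>x. frechet_derivative g (at x) 1"]) simp
next
  assume "\<exists>g'. (\<forall>x. (g has_real_derivative g' x) (at x)) \<and> Ck_map k g'"
  then obtain g' where g': "\<And>x. (g has_real_derivative g' x) (at x)" "Ck_map k g'" by auto
  have "frechet_derivative g (at x) = (*) (g' x)" for x
    using g'(1)[of x] frechet_derivative_at unfolding has_field_derivative_def by metis
  then show "Ck_map (Suc k) g"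
    using g' Ck_map_cmult[of k g']
    by (auto simp: differentiable_def has_field_derivative_def)
qed

declare Ck_map.simps(2) [simp del]

lemma Ck_map_SucD: "Ck_map (Suc k) (g :: real \<Rightarrow> real) \<Longrightarrow> Ck_map k g"
proof (induction k arbitrary: g)
  case 0
  then show ?case
    by (auto simp: Ck_map_Suc_iff continuous_on_eq_continuous_at intro: DERIV_isCont)
next
  case (Suc k)
  then show ?case by (subst Ck_map_Suc_iff, subst (asm) Ck_map_Suc_iff) blast
qed

lemma Ck_map_add:
  fixes g h :: "real \<Rightarrow> real"
  shows "Ck_map k g \<Longrightarrow> Ck_map k h \<Longrightarrow> Ck_map k (\<lambda>x. g x + h x)"
proof (induction k arbitrary: g h)
  case 0
  then show ?case by (auto intro: continuous_intros)
next
  case (Suc k)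
  obtain g' h' where g': "\<And>x. (g has_real_derivative g' x) (at x)" "Ck_map k g'"
    and h': "\<And>x. (h has_real_derivative h' x) (at x)" "Ck_map k h'"
    using Suc.prems unfolding Ck_map_Suc_iff by blast
  have "((\<lambda>x. g x + h x) has_real_derivative g' x + h' x) (at x)" for x
    by (intro DERIV_add g' h')
  then show ?case
    unfolding Ck_map_Suc_iff using Suc.IH[OF g'(2) h'(2)] by (intro exI[of _ "\<lambda>x. g' x + h' x"]) simp
qed

lemma Ck_map_mult:
  fixes g h :: "real \<Rightarrow> real"
  shows "Ck_map k g \<Longrightarrow> Ck_map k h \<Longrightarrow> Ck_map k (\<lambda>x. g x * h x)"
proof (induction k arbitrary: g h)
  case 0
  then show ?case by (auto intro: continuous_intros)
next
  case (Suc k)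
  obtain g' h' where g': "\<And>x. (g has_real_derivative g' x) (at x)" "Ck_map k g'"
    and h': "\<And>x. (h has_real_derivative h' x) (at x)" "Ck_map k h'"
    using Suc.prems unfolding Ck_map_Suc_iff by blast
  have "((\<lambda>x. g x * h x) has_real_derivative g' x * h x + h' x * g x) (at x)" for x
    by (intro DERIV_mult g' h')
  moreover have "Ck_map k (\<lambda>x. g' x * h x + h' x * g x)"
    by (intro Ck_map_add Suc.IH Suc.prems[THEN Ck_map_SucD] g' h')
  ultimately show ?case
    unfolding Ck_map_Suc_iff by (intro exI[of _ "\<lambda>x. g' x * h x + h' x * g x"]) simp
qed

lemma Ck_map_const: "Ck_map k (\<lambda>x::real. c::real)"
proof (induction k arbitrary: c)
  case (Suc k)
  then show ?case unfolding Ck_map_Suc_iff by (intro exI[of _ "\<lambda>_. 0"]) auto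
qed simp

text \<open>The span of the cosine and the sine of frequency \<open>c\<close> is closed under
  differentiation, so the induction must leave both coefficients free.\<close>

lemma Ck_map_trig: "Ck_map k (\<lambda>x::real. a * cos (c * x) + b * sin (c * x))"
proof (induction k arbitrary: a b)
  case 0
  show ?case by (auto intro!: continuous_intros)
next
  case (Suc k)
  have "((\<lambda>x. a * cos (c * x) + b * sin (c * x)) has_real_derivative
      (b * c) * cos (c * x) + (- a * c) * sin (c * x)) (at x)" for x
    by (auto intro!: derivative_eq_intros)
  then show ?case
    unfolding Ck_map_Suc_iff using Suc.IH[of "b * c" "- a * c"]
    by (intro exI[of _ "\<lambda>x. (b * c) * cos (c * x) + (- a * c) * sin (c * x)"]) simp
qed

lemma smooth_on_circle_continuous:
  assumes "smooth_on_circle g"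
  shows "continuous_on UNIV g"
  using assms Ck_map.simps(1) unfolding continuous_on_circle_iff smooth_on_circle_def smooth_map_def
  by blast

lemma smooth_on_circle_const: "smooth_on_circle (\<lambda>_. c)"
  by (simp add: smooth_on_circle_def smooth_map_def Ck_map_const)

lemma smooth_on_circle_add:
  "smooth_on_circle g \<Longrightarrow> smooth_on_circle h \<Longrightarrow> smooth_on_circle (\<lambda>t. g t + h t)"
  by (simp add: smooth_on_circle_def smooth_map_def Ck_map_add)

lemma smooth_on_circle_mult:
  "smooth_on_circle g \<Longrightarrow> smooth_on_circle h \<Longrightarrow> smooth_on_circle (\<lambda>t. g t * h t)"
  by (simp add: smooth_on_circle_def smooth_map_def Ck_map_mult)

lemma smooth_on_circle_cis:
  "smooth_on_circle (\<lambda>t. Re (circle_cis t))" "smooth_on_circle (\<lambda>t. Im (circle_cis t))"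
  using Ck_map_trig[of _ 1 "2 * pi" 0] Ck_map_trig[of _ 0 "2 * pi" 1]
  by (simp_all add: smooth_on_circle_def smooth_map_def circle_cis_to_circle)

text \<open>Stone-Weierstrass, applied to the algebra of smooth functions; the coordinates of
  \<open>circle_cis\<close> separate points.\<close>

lemma smooth_on_circle_dense:
  assumes "continuous_on UNIV g" "e > 0"
  obtains h where "smooth_on_circle h" "\<And>t. \<bar>g t - h t\<bar> < e"
proof -
  interpret function_ring_on "{h. smooth_on_circle h}" "UNIV :: circle set"
  proof
    fix x y :: circle assume "x \<noteq> y"
    then have "circle_cis x \<noteq> circle_cis y" using inj_circle_cis by (auto dest: injD)
    then have "Re (circle_cis x) \<noteq> Re (circle_cis y) \<or> Im (circle_cis x) \<noteq> Im (circle_cis y)"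
      by (auto simp: complex_eq_iff)
    then show "\<exists>f\<in>{h. smooth_on_circle h}. f x \<noteq> f y"
      using smooth_on_circle_cis by auto
  next
    show "compact (UNIV :: circle set)" by (rule compact_circle)
    show "continuous_on UNIV f" if "f \<in> {h. smooth_on_circle h}" for f :: "circle \<Rightarrow> real"
      using that smooth_on_circle_continuous by simp
  qed (simp_all add: smooth_on_circle_add smooth_on_circle_mult smooth_on_circle_const)
  show thesis using Stone_Weierstrass_basic[OF assms] that by auto
qed

text \<open>The mean over one period is the increment of a primitive over that period. When it
  vanishes, the primitive is periodic and descends to the circle.\<close>

lemma smooth_antiderivative:
  assumes "smooth_on_circle g" "(LINT t|circle_measure. g t) = 0"
  obtains h where "smooth_on_circle h" "has_circle_derivative h g"
proof -
  define p where "p s = g (to_circle s)" for s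
  have cont: "continuous_on UNIV p"
    unfolding p_def using smooth_on_circle_continuous[OF assms(1)] by (simp only: continuous_on_circle_iff)
  have "\<exists>P. \<forall>x::real. -\<infinity> < ereal x \<longrightarrow> ereal x < \<infinity> \<longrightarrow> (P has_vector_derivative p x) (at x)"
    using cont by (intro einterval_antiderivative) (auto simp: continuous_on_eq_continuous_at)
  then obtain P where P: "\<And>x. (P has_real_derivative p x) (at x)"
    by (auto simp: has_real_derivative_iff_has_vector_derivative)
  have "(P has_vector_derivative p x) (at x within {0..1})" for x
    using has_vector_derivative_at_within[OF P[of x, unfolded has_real_derivative_iff_has_vector_derivative]] .
  then have "(p has_integral P 1 - P 0) {0..1}"
    by (intro fundamental_theorem_of_calculus) auto
  then have "integral {0..1} p = P 1 - P 0" by (rule integral_unique)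
  moreover have "integral {0..1} p = 0"
    using assms(2) circle_integral_eq[OF integrable_continuous_circle[OF smooth_on_circle_continuous[OF assms(1)]]]
    by (simp add: p_def[abs_def])
  ultimately have "P 1 = P 0" by simp
  \<comment> \<open>As \<open>p\<close> has period 1, the difference \<open>P (x + 1) - P x\<close>
    has derivative zero, and it vanishes at \<open>x = 0\<close>.\<close>
  have P1: "P (x + 1) = P x" for x
  proof -
    have p1: "p (x + 1) = p x" for x
      using to_circle_add_int[of x 1] by (simp add: p_def)
    have "((\<lambda>x. P (x + 1)) has_real_derivative p x) (at x)" for x
      using P[of "x + 1"] DERIV_shift[of P "p x" x 1] by (simp add: p1)
    then have "((\<lambda>x. P (x + 1) - P x) has_real_derivative 0) (at x)" for x
      using DERIV_diff[OF _ P[of x]] by fastforce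
    then have "P (x + 1) - P x = P (0 + 1) - P 0"
      by (intro DERIV_isconst_all[of "\<lambda>x. P (x + 1) - P x"] allI)
    then show ?thesis using \<open>P 1 = P 0\<close> by simp
  qed
  have P_int: "P (x + of_int n) = P x" for x n
  proof -
    have nat: "P (x + of_nat m) = P x" for x m
    proof (induction m)
      case (Suc m)
      then show ?case using P1[of "x + of_nat m"] by (simp add: algebra_simps)
    qed simp
    show ?thesis
      \<comment> \<open>For negative \<open>n\<close> the forward steps start at
        \<open>x + of_int n\<close> and end at \<open>x\<close>.\<close>
      using nat[of x "nat n"] nat[of "x + of_int n" "nat (- n)"] by (cases "n \<ge> 0") auto
  qed
  then have per: "P s = P r" if "s - r \<in> \<int>" for s r
  proof -
    obtain n where "s - r = of_int n" using \<open>s - r \<in> \<int>\<close> by (auto elim: Ints_cases)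
    then have "s = r + of_int n" by simp
    then show ?thesis using P_int by simp
  qed
  define h where "h t = P (rep_circle t)" for t
  have h: "h (to_circle s) = P s" for s
  proof -
    have "to_circle (rep_circle (to_circle s)) = to_circle s"
      by (metis Quotient3_abs_rep Quotient3_circle)
    then show ?thesis unfolding h_def to_circle_eq_iff by (rule per)
  qed
  have "Ck_map k P" for k
  proof (rule Ck_map_SucD)
    have "Ck_map k p"
      using assms(1) by (simp add: smooth_on_circle_def smooth_map_def p_def[abs_def])
    then show "Ck_map (Suc k) P"
      unfolding Ck_map_Suc_iff using P by blast
  qed
  then have "smooth_on_circle h"
    by (simp add: smooth_on_circle_def smooth_map_def h)
  moreover have "has_circle_derivative h g"
    using P by (simp add: has_circle_derivative_def h p_def)
  ultimately show thesis by (rule that)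
qed

text \<open>The fundamental lemma of the calculus of variations for integrable \<open>w\<close>. By
  density, \<open>w\<close> is orthogonal to all continuous functions; testing with continuous
  functions that converge boundedly almost everywhere to the sign of \<open>w\<close> shows that the
  integral of its absolute value is zero.\<close>

lemma smooth_orthogonal_imp_zero:
  assumes w: "integrable circle_measure w"
    and orth: "\<And>\<psi>. smooth_on_circle \<psi> \<Longrightarrow> (LINT t|circle_measure. w t * \<psi> t) = 0"
  shows "AE t in circle_measure. w t = 0"
proof -
  have cont: "(LINT t|circle_measure. w t * g t) = 0" if g: "continuous_on UNIV g" for g
  proof -
    define B where "B = (LINT t|circle_measure. \<bar>w t\<bar>)"
    have B: "0 \<le> B" by (simp add: B_def)
    have "\<bar>LINT t|circle_measure. w t * g t\<bar> \<le> 0 + e" if e: "e > 0" for e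
    proof -
      \<comment> \<open>The total error is at most \<open>B / (B + 1) * e\<close>; the added 1
        covers \<open>B = 0\<close>.\<close>
      obtain h where h: "smooth_on_circle h" "\<And>t. \<bar>g t - h t\<bar> < e / (B + 1)"
        using smooth_on_circle_dense[OF g, of "e / (B + 1)"] e B by auto
      note hc = smooth_on_circle_continuous[OF h(1)]
      have "(LINT t|circle_measure. w t * (g t - h t)) = (LINT t|circle_measure. w t * g t - w t * h t)"
        by (simp add: right_diff_distrib)
      also have "\<dots> = (LINT t|circle_measure. w t * g t)"
        using orth[OF h(1)] integrable_mult_continuous[OF w g] integrable_mult_continuous[OF w hc] by simp
      finally have "\<bar>LINT t|circle_measure. w t * g t\<bar> \<le> (LINT t|circle_measure. \<bar>w t * (g t - h t)\<bar>)"
        using integral_abs_bound[of circle_measure "\<lambda>t. w t * (g t - h t)"] by simp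
      also have "\<dots> \<le> (LINT t|circle_measure. \<bar>w t\<bar> * (e / (B + 1)))"
      proof (rule integral_mono)
        show "integrable circle_measure (\<lambda>t. \<bar>w t * (g t - h t)\<bar>)"
          by (intro integrable_abs integrable_mult_continuous w continuous_intros g hc)
        show "integrable circle_measure (\<lambda>t. \<bar>w t\<bar> * (e / (B + 1)))"
          using w by simp
        show "\<bar>w t * (g t - h t)\<bar> \<le> \<bar>w t\<bar> * (e / (B + 1))" for t
          unfolding abs_mult using h(2)[of t] by (intro mult_left_mono) auto
      qed
      also have "\<dots> = B / (B + 1) * e" by (simp add: B_def)
      also have "\<dots> \<le> 1 * e" using B e by (intro mult_right_mono) (auto simp: divide_simps)
      finally show ?thesis by simp
    qed
    then have "\<bar>LINT t|circle_measure. w t * g t\<bar> \<le> 0" by (rule field_le_epsilon)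
    then show ?thesis by simp
  qed
  define x where "x s = w (to_circle s)" for s
  have [measurable]: "w \<in> borel_measurable borel" using w by auto
  have x_ai: "x absolutely_integrable_on {0..1}"
    using circle_absolutely_integrable[OF w] by (simp add: x_def[abs_def])
  have "(\<lambda>s. sgn (x s)) \<in> borel_measurable borel"
    unfolding x_def sgn_if by measurable
  then have "(\<lambda>s. sgn (x s)) \<in> borel_measurable (lebesgue_on {0..1})"
    by (intro measurable_restrict_space1) (simp add: measurable_completion)
  then have "(\<lambda>s. sgn (x s)) measurable_on {0..1}"
    by (subst measurable_on_iff_borel_measurable) auto
  \<comment> \<open>A measurable function is a limit of continuous functions off a negligible set.
    These functions need be neither bounded nor equal at 0 and 1.\<close>
  then obtain N g where N: "negligible N" and gc: "\<And>n. continuous_on UNIV (g n)"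
    and glim: "\<And>s. s \<notin> N \<Longrightarrow> (\<lambda>n. g n s) \<longlonglongrightarrow> (if s \<in> {0..1} then sgn (x s) else 0)"
    unfolding measurable_on_def by blast
  \<comment> \<open>The factor \<open>cut n\<close> vanishes at 0 and 1, so that \<open>q n\<close>
    descends to the circle, and tends to 1 in between. Clamping \<open>g n\<close> to the interval
    from -1 to 1 provides the domination of \<open>x s * q n s\<close> by
    \<open>\<bar>x s\<bar>\<close>.\<close>
  define cut where "cut n s = max 0 (min 1 (min (real n * s) (real n * (1 - s))))" for n s
  define q where "q n s = max (-1) (min 1 (g n s)) * cut n s" for n s
  have qc: "continuous_on {0..1} (q n)" for n
    unfolding q_def cut_def using gc continuous_on_subset by (intro continuous_intros) blast
  have q_le: "\<bar>q n s\<bar> \<le> 1" for n s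
    unfolding q_def abs_mult by (rule mult_le_one) (auto simp: cut_def)
  have int0: "integral {0..1} (\<lambda>s. x s * q n s) = 0"
    and int_q: "(\<lambda>s. x s * q n s) integrable_on {0..1}" for n
  proof -
    have "q n 0 = q n 1" by (simp add: q_def cut_def)
    then obtain u :: C0_circle where u: "\<And>s. s \<in> {0..1} \<Longrightarrow> apply_bcontfun u (to_circle s) = q n s"
      using descend_to_circle[OF qc[of n]] by blast
    have uc: "continuous_on UNIV (apply_bcontfun u)" by simp
    have i: "integrable circle_measure (\<lambda>t. w t * apply_bcontfun u t)"
      by (rule integrable_mult_continuous[OF w uc])
    have eq: "w (to_circle s) * apply_bcontfun u (to_circle s) = x s * q n s" if "s \<in> {0..1}" for s
      using u[OF that] by (simp add: x_def)
    have "integral {0..1} (\<lambda>s. x s * q n s)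
        = integral {0..1} (\<lambda>s. w (to_circle s) * apply_bcontfun u (to_circle s))"
      by (rule Henstock_Kurzweil_Integration.integral_cong) (simp add: eq)
    then show "integral {0..1} (\<lambda>s. x s * q n s) = 0"
      using circle_integral_eq[OF i] cont[OF uc] by simp
    have "(\<lambda>s. w (to_circle s) * apply_bcontfun u (to_circle s)) integrable_on {0..1}"
      using circle_absolutely_integrable[OF i] by (simp add: absolutely_integrable_on_def)
    then show "(\<lambda>s. x s * q n s) integrable_on {0..1}"
      by (rule integrable_eq) (simp add: eq)
  qed
  \<comment> \<open>On \<open>S\<close> the convergence holds at every point, as the dominated
    convergence theorem for the gauge integral requires; the omitted set changes no
    integral.\<close>
  define S where "S = {0..1} - (N \<union> {0, 1})"
  have neg: "negligible (N \<union> {0, 1})" using N by auto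
  have spike: "(f has_integral y) S \<longleftrightarrow> (f has_integral y) {0..1}" for f :: "real \<Rightarrow> real" and y
  proof (rule has_integral_spike_set_eq)
    show "negligible {s \<in> S - {0..1}. f s \<noteq> 0}"
      by (rule negligible_subset[OF neg]) (auto simp: S_def)
    show "negligible {s \<in> {0..1} - S. f s \<noteq> 0}"
      by (rule negligible_subset[OF neg]) (auto simp: S_def)
  qed
  have lim: "(\<lambda>n. x s * q n s) \<longlonglongrightarrow> \<bar>x s\<bar>" if s: "s \<in> S" for s
  proof -
    have s': "s \<notin> N" "0 < s" "s < 1" using s by (auto simp: S_def)
    obtain m :: nat where m: "real m > max (1 / s) (1 / (1 - s))" using reals_Archimedean2 by blast
    have "cut n s = 1" if n: "n \<ge> m" for n
    proof -
      have "real n > 1 / s" "real n > 1 / (1 - s)" using m n by auto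
      then have "real n * s > 1" "real n * (1 - s) > 1" using s' by (auto simp: divide_simps)
      then show ?thesis by (simp add: cut_def)
    qed
    then have "(\<lambda>n. cut n s) \<longlonglongrightarrow> 1"
      by (intro tendsto_eventually) (auto simp: eventually_sequentially)
    moreover have "(\<lambda>n. max (-1) (min 1 (g n s))) \<longlonglongrightarrow> max (-1) (min 1 (sgn (x s)))"
      using glim[OF s'(1)] s' by (intro tendsto_intros) simp
    ultimately have "(\<lambda>n. x s * q n s) \<longlonglongrightarrow> x s * (max (-1) (min 1 (sgn (x s))) * 1)"
      unfolding q_def by (intro tendsto_mult tendsto_const)
    moreover have "x s * (max (-1) (min 1 (sgn (x s))) * 1) = \<bar>x s\<bar>"
      by (simp add: sgn_if abs_if)
    ultimately show ?thesis by (simp only:)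
  qed
  have "(\<lambda>n. integral S (\<lambda>s. x s * q n s)) \<longlonglongrightarrow> integral S (\<lambda>s. \<bar>x s\<bar>)"
  proof (rule dominated_convergence(2))
    show "(\<lambda>s. x s * q n s) integrable_on S" for n
      using int_q[of n] unfolding integrable_on_def spike .
    show "(\<lambda>s. \<bar>x s\<bar>) integrable_on S"
      using x_ai unfolding absolutely_integrable_on_def integrable_on_def spike by simp
    show "norm (x s * q n s) \<le> \<bar>x s\<bar>" for n s
      using q_le[of n s] mult_left_le[of "\<bar>q n s\<bar>" "\<bar>x s\<bar>"] by (simp add: abs_mult)
  qed (rule lim)
  moreover have "integral S f = integral {0..1} f" for f :: "real \<Rightarrow> real"
    by (simp add: integral_def integrable_on_def spike)
  ultimately have "integral {0..1} (\<lambda>s. \<bar>x s\<bar>) = 0"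
    using int0 by (simp add: LIMSEQ_const_iff)
  then have "(LINT t|circle_measure. \<bar>w t\<bar>) = 0"
    using circle_integral_eq[OF integrable_abs[OF w]] by (simp add: x_def)
  then have "AE t in circle_measure. \<bar>w t\<bar> = 0"
    using w by (subst (asm) integral_nonneg_eq_0_iff_AE) auto
  then show ?thesis by simp
qed

text \<open>The primitive of an \<open>x\<close> that is merely integrable may fail to be
  differentiable at some points, so the product rule does not apply. Fubini on the triangle
  \<open>r \<le> s\<close> takes its place.\<close>

lemma primitive_by_parts:
  fixes x p p' :: "real \<Rightarrow> real"
  assumes x [measurable]: "x \<in> borel_measurable borel" and xi: "set_integrable lborel {0..1} x"
    and p: "\<And>s. (p has_real_derivative p' s) (at s)" and p': "continuous_on UNIV p'"
  shows "integral {0..1} (\<lambda>s. integral {0..s} x * p' s)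
    = integral {0..1} x * p 1 - integral {0..1} (\<lambda>s. x s * p s)"
proof -
  define y where "y r = indicator {0..1} r * x r" for r :: real
  define d where "d s = indicator {0..1} s * p' s" for s :: real
  have [measurable]: "p' \<in> borel_measurable borel"
    by (rule borel_measurable_continuous_onI[OF p'])
  have [measurable]: "y \<in> borel_measurable borel" "d \<in> borel_measurable borel"
    unfolding y_def d_def by measurable
  have yi: "integrable lborel y"
    using xi by (simp add: set_integrable_def y_def[abs_def])
  have p'_set: "set_integrable lborel {a..b} p'" for a b
    by (intro borel_integrable_atLeastAtMost' continuous_on_subset[OF p']) simp
  have di: "integrable lborel d"
    using p'_set[of 0 1] by (simp add: set_integrable_def d_def[abs_def])
  \<comment> \<open>Integrating over \<open>r\<close> first produces the primitive of
    \<open>x\<close> times \<open>p'\<close>; integrating over \<open>s\<close> first produces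
    \<open>x r * (p 1 - p r)\<close>.\<close>
  define f where "f r s = y r * d s * (if r \<le> s then 1 else 0)" for r s
  have prod: "integrable (lborel \<Otimes>\<^sub>M lborel) (\<lambda>(r, s). y r * d s)"
  proof (rule lborel_pair.Fubini_integrable)
    show "integrable lborel (\<lambda>r. LINT s|lborel. norm (case (r, s) of (r, s) \<Rightarrow> y r * d s))"
      using yi by (simp add: abs_mult)
    show "AE r in lborel. integrable lborel (\<lambda>s. case (r, s) of (r, s) \<Rightarrow> y r * d s)"
      using di by simp
  qed measurable
  have fi: "integrable (lborel \<Otimes>\<^sub>M lborel) (case_prod f)"
  proof (rule Bochner_Integration.integrable_bound[OF prod])
    show "case_prod f \<in> borel_measurable (lborel \<Otimes>\<^sub>M lborel)"
      unfolding f_def by measurable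
    show "AE z in lborel \<Otimes>\<^sub>M lborel. norm (case_prod f z) \<le> norm (case z of (r, s) \<Rightarrow> y r * d s)"
      by (auto simp: f_def)
  qed
  have inner_r: "(LINT r|lborel. f r s) = indicator {0..1} s *\<^sub>R (integral {0..s} x * p' s)" for s
  proof (cases "s \<in> {0..1}")
    case True
    have xs: "set_integrable lborel {0..s} x"
      by (rule set_integrable_subset[OF xi]) (use True in auto)
    have "f r s = p' s * (indicator {0..s} r *\<^sub>R x r)" for r
      using True by (auto simp: f_def y_def d_def indicator_def)
    then have "(LINT r|lborel. f r s) = p' s * (LINT r:{0..s}|lborel. x r)"
      by (simp add: set_lebesgue_integral_def)
    then show ?thesis
      using set_borel_integral_eq_integral(2)[OF xs] True by (simp add: mult.commute)
  qed (simp add: f_def d_def)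
  have inner_s: "(LINT s|lborel. f r s) = indicator {0..1} r *\<^sub>R (x r * (p 1 - p r))" for r
  proof (cases "r \<in> {0..1}")
    case True
    have "f r s = y r * (indicator {r..1} s *\<^sub>R p' s)" for s
      using True by (auto simp: f_def d_def indicator_def)
    then have "(LINT s|lborel. f r s) = y r * (LINT s:{r..1}|lborel. p' s)"
      by (simp add: set_lebesgue_integral_def)
    also have "(LINT s:{r..1}|lborel. p' s) = integral {r..1} p'"
      by (rule set_borel_integral_eq_integral(2)[OF p'_set])
    also have "(p' has_integral p 1 - p r) {r..1}"
      using True has_vector_derivative_at_within[OF p[unfolded has_real_derivative_iff_has_vector_derivative]]
      by (intro fundamental_theorem_of_calculus) auto
    then have "integral {r..1} p' = p 1 - p r" by (rule integral_unique)
    finally show ?thesis using True by (simp add: y_def)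
  qed (simp add: f_def y_def)
  have "set_integrable lborel {0..1} (\<lambda>s. integral {0..s} x * p' s)"
    using lborel_pair.integrable_snd[OF fi] unfolding inner_r set_integrable_def .
  note L = set_borel_integral_eq_integral[OF this]
  have "set_integrable lborel {0..1} (\<lambda>r. x r * (p 1 - p r))"
    using lborel_pair.integrable_fst[OF fi] unfolding inner_s set_integrable_def .
  note R = set_borel_integral_eq_integral[OF this]
  have "integral {0..1} (\<lambda>s. integral {0..s} x * p' s) = integral {0..1} (\<lambda>r. x r * (p 1 - p r))"
    using lborel_pair.Fubini_integral[OF fi] L(2) R(2)
    unfolding inner_r inner_s set_lebesgue_integral_def by simp
  also have "x integrable_on {0..1}" using set_borel_integral_eq_integral[OF xi] by simp
  then have xp: "(\<lambda>r. x r * p 1) integrable_on {0..1}" by (rule integrable_on_mult_left)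
  have "integral {0..1} (\<lambda>r. x r * p 1 - x r * (p 1 - p r))
      = integral {0..1} (\<lambda>r. x r * p 1) - integral {0..1} (\<lambda>r. x r * (p 1 - p r))"
    by (rule Henstock_Kurzweil_Integration.integral_diff[OF xp R(1)])
  then have "integral {0..1} (\<lambda>r. x r * (p 1 - p r)) = integral {0..1} x * p 1 - integral {0..1} (\<lambda>r. x r * p r)"
    by (simp add: right_diff_distrib)
  finally show ?thesis .
qed

section \<open>Primitives and weak derivatives\<close>

text \<open>The bound is uniform in the interval, so convergence in L^1 makes the primitives
  converge uniformly.\<close>

lemma circle_integral_diff_le:
  fixes v w :: "circle \<Rightarrow> real"
  assumes v: "integrable circle_measure v" and w: "integrable circle_measure w" and ab: "0 \<le> a" "b \<le> 1"
  shows "\<bar>integral {a..b} (\<lambda>s. v (to_circle s)) - integral {a..b} (\<lambda>s. w (to_circle s))\<bar>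
    \<le> (LINT t|circle_measure. \<bar>v t - w t\<bar>)"
proof -
  let ?v = "\<lambda>s. v (to_circle s)" and ?w = "\<lambda>s. w (to_circle s)"
  have i: "integrable circle_measure (\<lambda>t. v t - w t)" using v w by simp
  have sub: "{a..b} \<subseteq> {0..1}" using ab by auto
  have vi: "?v integrable_on {a..b}" and wi: "?w integrable_on {a..b}"
    using circle_absolutely_integrable[OF v] circle_absolutely_integrable[OF w] sub
    by (auto simp: absolutely_integrable_on_def intro: integrable_on_subinterval)
  have abs_i: "(\<lambda>s. \<bar>?v s - ?w s\<bar>) integrable_on {0..1}"
    using circle_absolutely_integrable[OF i] by (simp add: absolutely_integrable_on_def)
  then have abs_ab: "(\<lambda>s. \<bar>?v s - ?w s\<bar>) integrable_on {a..b}"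
    by (rule integrable_on_subinterval[OF _ sub])
  have "\<bar>integral {a..b} ?v - integral {a..b} ?w\<bar> = \<bar>integral {a..b} (\<lambda>s. ?v s - ?w s)\<bar>"
    using Henstock_Kurzweil_Integration.integral_diff[OF vi wi] by simp
  also have "\<dots> \<le> integral {a..b} (\<lambda>s. \<bar>?v s - ?w s\<bar>)"
    using integral_norm_bound_integral[OF Henstock_Kurzweil_Integration.integrable_diff[OF vi wi] abs_ab] by simp
  also have "\<dots> \<le> integral {0..1} (\<lambda>s. \<bar>?v s - ?w s\<bar>)"
    by (rule integral_subset_le[OF sub abs_ab abs_i]) simp
  also have "\<dots> = (LINT t|circle_measure. \<bar>v t - w t\<bar>)"
    using circle_integral_eq[OF integrable_abs[OF i]] by simp
  finally show ?thesis .
qed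

text \<open>Absolute continuity with derivative \<open>v\<close>, in integrated form. It is the
  common format for the two choices of spaces. The case \<open>a = 0\<close>, \<open>b = 1\<close>
  forces \<open>v\<close> to have mean zero.\<close>

definition circle_primitive :: "C0_circle \<Rightarrow> (circle \<Rightarrow> real) \<Rightarrow> bool" where
  "circle_primitive w v \<longleftrightarrow> (\<lambda>s. v (to_circle s)) absolutely_integrable_on {0..1} \<and>
     (\<forall>a b. 0 \<le> a \<longrightarrow> a \<le> b \<longrightarrow> b \<le> 1 \<longrightarrow>
       apply_bcontfun w (to_circle b) - apply_bcontfun w (to_circle a) = integral {a..b} (\<lambda>s. v (to_circle s)))"

lemma square_integrable_continuous:
  assumes "continuous_on UNIV g"
  shows "square_integrable g"
  using borel_measurable_continuous_onI[OF assms] assms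
  by (auto simp: square_integrable_def intro!: integrable_continuous_circle continuous_intros)

lemma square_integrable_imp_integrable: "square_integrable u \<Longrightarrow> integrable circle_measure u"
  using square_integrable_mult[of u "\<lambda>_. 1"] square_integrable_continuous[of "\<lambda>_. 1"] by simp

lemma smooth_on_circle_derivative_continuous:
  assumes "smooth_on_circle h" "has_circle_derivative h h'"
  shows "continuous_on UNIV h'"
proof -
  have "Ck_map (Suc 0) (\<lambda>s. h (to_circle s))"
    using assms(1) by (simp only: smooth_on_circle_def smooth_map_def)
  then obtain p' where p': "\<And>s. ((\<lambda>s. h (to_circle s)) has_real_derivative p' s) (at s)" "continuous_on UNIV p'"
    unfolding Ck_map_Suc_iff by auto
  have "p' = (\<lambda>s. h' (to_circle s))"
    using p'(1) assms(2) DERIV_unique unfolding has_circle_derivative_def by blast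
  then show ?thesis using p'(2) by (simp add: continuous_on_circle_iff[of h'])
qed

text \<open>The lemma of du Bois-Reymond. The primitive \<open>w0\<close> of \<open>v\<close> has
  the same weak derivative as \<open>u\<close>, so \<open>z = u - w0\<close> is orthogonal to every
  derivative of a smooth function, that is, to every smooth function of mean zero; hence
  \<open>z\<close> is almost everywhere equal to its mean.\<close>

lemma weak_derivative_imp_primitive:
  assumes u: "square_integrable u" and v: "square_integrable v"
    and weak: "\<And>\<phi> \<phi>'. smooth_on_circle \<phi> \<Longrightarrow> has_circle_derivative \<phi> \<phi>' \<Longrightarrow>
       (LINT t|circle_measure. u t * \<phi>' t) = - (LINT t|circle_measure. v t * \<phi> t)"
  obtains w where "AE t in circle_measure. u t = apply_bcontfun w t" "circle_primitive w v"
proof -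
  note ui = square_integrable_imp_integrable[OF u] and vi = square_integrable_imp_integrable[OF v]
  define x where "x s = v (to_circle s)" for s
  define W where "W s = integral {0..s} x" for s
  have [measurable]: "v \<in> borel_measurable borel" using v by (simp add: square_integrable_def)
  have [measurable]: "x \<in> borel_measurable borel" unfolding x_def by measurable
  have x_ai: "x absolutely_integrable_on {0..1}"
    using circle_absolutely_integrable[OF vi] by (simp add: x_def[abs_def])
  then have x_i: "x integrable_on {0..1}" by (simp add: absolutely_integrable_on_def)
  have x_set: "set_integrable lborel {0..1} x"
    using x_ai unfolding set_integrable_def by (subst (asm) integrable_completion) auto
  \<comment> \<open>Testing with the constant 1 shows that \<open>v\<close> has mean zero, so its
    primitive \<open>W\<close> closes up on the circle.\<close>
  have "has_circle_derivative (\<lambda>_. 1) (\<lambda>_. 0)" by (simp add: has_circle_derivative_def)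
  from weak[OF smooth_on_circle_const this] have W1: "W 1 = 0"
    using circle_integral_eq[OF vi] by (simp add: W_def x_def[abs_def])
  have W0: "W 0 = 0" by (simp add: W_def)
  have W_cont: "continuous_on {0..1} W"
    unfolding W_def by (rule indefinite_integral_continuous_1[OF x_i])
  obtain w0 :: C0_circle where w0: "\<And>s. s \<in> {0..1} \<Longrightarrow> apply_bcontfun w0 (to_circle s) = W s"
    using descend_to_circle[OF W_cont] W0 W1 by auto
  have w0c: "continuous_on UNIV (apply_bcontfun w0)" by simp
  have w0i: "integrable circle_measure (apply_bcontfun w0)"
    by (rule integrable_continuous_circle[OF w0c])
  define z where "z t = u t - apply_bcontfun w0 t" for t
  have zi: "integrable circle_measure z" unfolding z_def using ui w0i by simp
  have zero: "(LINT t|circle_measure. z t * h' t) = 0"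
    if h: "smooth_on_circle h" "has_circle_derivative h h'" for h h'
  proof -
    note h'c = smooth_on_circle_derivative_continuous[OF h] and hc = smooth_on_circle_continuous[OF h(1)]
    have hs: "((\<lambda>s. h (to_circle s)) has_real_derivative h' (to_circle s)) (at s)" for s
      using h(2) by (simp add: has_circle_derivative_def)
    have h's: "continuous_on UNIV (\<lambda>s. h' (to_circle s))"
      using h'c by (simp only: continuous_on_circle_iff)
    have "(LINT t|circle_measure. apply_bcontfun w0 t * h' t)
        = integral {0..1} (\<lambda>s. apply_bcontfun w0 (to_circle s) * h' (to_circle s))"
      by (rule circle_integral_eq[OF integrable_mult_continuous[OF w0i h'c]])
    also have "\<dots> = integral {0..1} (\<lambda>s. integral {0..s} x * h' (to_circle s))"
      by (rule Henstock_Kurzweil_Integration.integral_cong) (simp add: w0 W_def)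
    \<comment> \<open>The boundary term of the integration by parts has the factor
      \<open>W 1 = 0\<close>.\<close>
    also have "\<dots> = - integral {0..1} (\<lambda>s. x s * h (to_circle s))"
      using primitive_by_parts[OF _ x_set hs h's] W1 by (simp add: W_def)
    also have "\<dots> = - (LINT t|circle_measure. v t * h t)"
      using circle_integral_eq[OF integrable_mult_continuous[OF vi hc]] by (simp add: x_def)
    finally have "(LINT t|circle_measure. apply_bcontfun w0 t * h' t) = (LINT t|circle_measure. u t * h' t)"
      using weak[OF h] by simp
    then show ?thesis
      unfolding z_def left_diff_distrib
      using integrable_mult_continuous[OF ui h'c] integrable_mult_continuous[OF w0i h'c] by simp
  qed
  define c where "c = (LINT t|circle_measure. z t)"
  have "AE t in circle_measure. z t - c = 0"
  proof (rule smooth_orthogonal_imp_zero)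
    show "integrable circle_measure (\<lambda>t. z t - c)" using zi by simp
    fix \<psi> assume \<psi>: "smooth_on_circle \<psi>"
    note \<psi>c = smooth_on_circle_continuous[OF \<psi>]
    note \<psi>i = integrable_continuous_circle[OF \<psi>c] and z\<psi>i = integrable_mult_continuous[OF zi \<psi>c]
    define m where "m = (LINT t|circle_measure. \<psi> t)"
    \<comment> \<open>The circle has measure 1, so subtracting \<open>m\<close> makes the mean zero
      and \<open>\<psi> - m\<close> is the derivative of a smooth function. Orthogonality to it
      gives \<open>m * c\<close> for the integral of \<open>z * \<psi>\<close>, which is exactly the
      integral of \<open>c * \<psi>\<close>.\<close>
    have "smooth_on_circle (\<lambda>t. \<psi> t + - m)"
      by (intro smooth_on_circle_add \<psi> smooth_on_circle_const)
    moreover have "(LINT t|circle_measure. \<psi> t + - m) = 0"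
      using \<psi>i by (simp add: m_def)
    ultimately obtain h where "smooth_on_circle h" "has_circle_derivative h (\<lambda>t. \<psi> t + - m)"
      by (rule smooth_antiderivative)
    from zero[OF this] have "(LINT t|circle_measure. z t * \<psi> t - m * z t) = 0"
      by (simp add: algebra_simps)
    then have "(LINT t|circle_measure. z t * \<psi> t) = m * c"
      using z\<psi>i zi by (simp add: c_def)
    then show "(LINT t|circle_measure. (z t - c) * \<psi> t) = 0"
      unfolding left_diff_distrib using z\<psi>i \<psi>i by (simp add: m_def)
  qed
  then have "AE t in circle_measure. u t = apply_bcontfun (w0 + const_bcontfun c) t"
    by eventually_elim (simp add: z_def plus_bcontfun.rep_eq const_bcontfun.rep_eq)
  moreover have "circle_primitive (w0 + const_bcontfun c) v"
    unfolding circle_primitive_def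
  proof (intro conjI allI impI)
    show "(\<lambda>s. v (to_circle s)) absolutely_integrable_on {0..1}"
      by (rule circle_absolutely_integrable[OF vi])
    fix a b :: real assume ab: "0 \<le> a" "a \<le> b" "b \<le> 1"
    have "x integrable_on {0..b}"
      by (rule integrable_on_subinterval[OF x_i]) (use ab in auto)
    then have "W b - W a = integral {a..b} x"
      unfolding W_def using Henstock_Kurzweil_Integration.integral_combine[OF ab(1,2), of x] by simp
    then show "apply_bcontfun (w0 + const_bcontfun c) (to_circle b)
        - apply_bcontfun (w0 + const_bcontfun c) (to_circle a) = integral {a..b} (\<lambda>s. v (to_circle s))"
      using ab by (simp add: plus_bcontfun.rep_eq const_bcontfun.rep_eq w0 x_def[abs_def])
  qed
  ultimately show thesis by (rule that)
qed

section \<open>A priori bounds\<close>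

text \<open>After the last time at which \<open>u \<le> R\<close>, the term \<open>- h\<close> can
  only push \<open>u\<close> down, so any growth beyond \<open>R\<close> is paid for by
  \<open>g\<close>.\<close>

lemma barrier_forward:
  fixes u g h :: "real \<Rightarrow> real"
  assumes ab: "a \<le> b" and u: "continuous_on {a..b} u"
    and g: "g absolutely_integrable_on {a..b}" and h: "h integrable_on {a..b}"
    and inc: "\<And>x y. a \<le> x \<Longrightarrow> x \<le> y \<Longrightarrow> y \<le> b \<Longrightarrow> u y - u x = integral {x..y} (\<lambda>s. g s - h s)"
    and ua: "u a \<le> R" and barrier: "\<And>s. s \<in> {a..b} \<Longrightarrow> R \<le> u s \<Longrightarrow> 0 \<le> h s"
  shows "u b \<le> R + integral {a..b} (\<lambda>s. \<bar>g s\<bar>)"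
proof (cases "u b \<le> R")
  case True
  have "0 \<le> integral {a..b} (\<lambda>s. \<bar>g s\<bar>)" by (rule Henstock_Kurzweil_Integration.integral_nonneg)
      (use g in \<open>auto simp: absolutely_integrable_on_def\<close>)
  then show ?thesis using True by simp
next
  case False
  define A where "A = {a..b} \<inter> u -` {..R}"
  have "closed (u -` {..R} \<inter> {a..b})"
    using u continuous_on_closed_vimage[of "{a..b}" u] by auto
  then have "compact ({a..b} \<inter> (u -` {..R} \<inter> {a..b}))"
    by (intro compact_Int_closed) auto
  moreover have "{a..b} \<inter> (u -` {..R} \<inter> {a..b}) = A" by (auto simp: A_def)
  ultimately have "compact A" by simp
  moreover have "a \<in> A" using ua ab by (simp add: A_def)
  ultimately obtain s where s: "s \<in> A" and max: "\<And>r. r \<in> A \<Longrightarrow> r \<le> s"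
    using compact_attains_sup[of A] by blast
  have sab: "a \<le> s" "s \<le> b" "u s \<le> R" using s by (auto simp: A_def)
  \<comment> \<open>The value \<open>R\<close> is attained at or after \<open>s\<close>; since
    \<open>s\<close> is the last point of \<open>A\<close>, this happens at \<open>s\<close>
    itself.\<close>
  obtain z where z: "s \<le> z" "z \<le> b" "u z = R"
    using IVT'[of u s R b] sab False u continuous_on_subset[OF u, of "{s..b}"] by auto
  have "z \<in> A" using z sab by (simp add: A_def)
  then have us: "u s = R" using max z by force
  have above: "R \<le> u r" if "r \<in> {s..b}" for r
  proof (rule ccontr)
    assume r: "\<not> R \<le> u r"
    then have "r \<in> A" using that sab by (simp add: A_def)
    then have "r = s" using max that by force
    then show False using r us by simp
  qed
  have gi: "g integrable_on {s..b}" "(\<lambda>s. \<bar>g s\<bar>) integrable_on {s..b}" "(\<lambda>s. \<bar>g s\<bar>) integrable_on {a..b}"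
    using absolutely_integrable_on_subinterval[OF g, of s b] sab g by (auto simp: absolutely_integrable_on_def)
  have hi: "h integrable_on {s..b}"
    by (rule integrable_on_subinterval[OF h]) (use sab in auto)
  have "u b - u s = integral {s..b} (\<lambda>r. g r - h r)"
    using inc[of s b] sab by simp
  also have "\<dots> \<le> integral {s..b} (\<lambda>r. \<bar>g r\<bar>)"
  proof (rule integral_le)
    show "(\<lambda>r. g r - h r) integrable_on {s..b}"
      by (rule Henstock_Kurzweil_Integration.integrable_diff[OF gi(1) hi])
    show "g r - h r \<le> \<bar>g r\<bar>" if r: "r \<in> {s..b}" for r
      using barrier[of r] above[OF r] r sab by auto
  qed (rule gi)
  also have "\<dots> \<le> integral {a..b} (\<lambda>r. \<bar>g r\<bar>)"
    by (rule integral_subset_le) (use gi sab in auto)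
  finally show ?thesis using us by simp
qed

text \<open>The barrier argument runs forward from \<open>t0\<close>. A time before
  \<open>t0\<close> is reached by wrapping around through \<open>u a = u b\<close>.\<close>

lemma periodic_upper_bound_nonneg:
  fixes u g h :: "real \<Rightarrow> real"
  assumes u: "continuous_on {a..b} u" and per: "u a = u b"
    and g: "g absolutely_integrable_on {a..b}" and h: "h integrable_on {a..b}"
    and inc: "\<And>x y. a \<le> x \<Longrightarrow> x \<le> y \<Longrightarrow> y \<le> b \<Longrightarrow> u y - u x = integral {x..y} (\<lambda>s. g s - h s)"
    and barrier: "\<And>s. s \<in> {a..b} \<Longrightarrow> R \<le> u s \<Longrightarrow> 0 \<le> h s"
    and t0: "t0 \<in> {a..b}" "u t0 \<le> R" and t: "t \<in> {a..b}"
  shows "u t \<le> R + integral {a..b} (\<lambda>s. \<bar>g s\<bar>)"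
proof -
  let ?I = "\<lambda>x y. integral {x..y} (\<lambda>s. \<bar>g s\<bar>)"
  have gi: "(\<lambda>s. \<bar>g s\<bar>) integrable_on {x..y}" if "a \<le> x" "y \<le> b" for x y
    using absolutely_integrable_on_subinterval[OF g, of x y] that by (auto simp: absolutely_integrable_on_def)
  have mono: "?I x y \<le> ?I x' y'" if "a \<le> x'" "x' \<le> x" "y \<le> y'" "y' \<le> b" for x y x' y'
    by (rule integral_subset_le) (use gi that in auto)
  \<comment> \<open>The starting level \<open>R'\<close> may exceed \<open>R\<close>, so that the
    bound reached at \<open>b\<close> can be taken as the starting level at
    \<open>a\<close>.\<close>
  have step: "u y \<le> R' + ?I x y" if "a \<le> x" "x \<le> y" "y \<le> b" "u x \<le> R'" "R \<le> R'" for x y R'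
  proof (rule barrier_forward)
    show "continuous_on {x..y} u" by (rule continuous_on_subset[OF u]) (use that in auto)
    show "g absolutely_integrable_on {x..y}"
      by (rule absolutely_integrable_on_subinterval[OF g]) (use that in auto)
    show "h integrable_on {x..y}"
      by (rule integrable_on_subinterval[OF h]) (use that in auto)
  qed (use that barrier inc in auto)
  show ?thesis
  proof (cases "t0 \<le> t")
    case True
    then have "u t \<le> R + ?I t0 t" using step t0 t by auto
    also have "\<dots> \<le> R + ?I a b" using mono[of a t0 t b] t0 t by auto
    finally show ?thesis .
  next
    case False
    have ge0: "0 \<le> ?I t0 b"
      using mono[of t0 t0 t0 b] t0 by simp
    \<comment> \<open>The two stretches, from \<open>t0\<close> to \<open>b\<close> and from
      \<open>a\<close> to \<open>t\<close>, do not overlap when \<open>t < t0\<close>, so together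
      they use the integral of \<open>\<bar>g\<bar>\<close> at most once.\<close>
    have "u b \<le> R + ?I t0 b" using step[of t0 b] t0 by auto
    then have "u t \<le> (R + ?I t0 b) + ?I a t"
      using step[of a t "R + ?I t0 b"] t per ge0 by auto
    also have "\<dots> \<le> R + ?I t0 b + ?I a t0" using mono[of a a t t0] False t t0 by auto
    also have "?I a t0 + ?I t0 b = ?I a b"
      using t0 gi[of a b] by (intro Henstock_Kurzweil_Integration.integral_combine) auto
    then have "R + ?I t0 b + ?I a t0 = R + ?I a b" by simp
    finally show ?thesis .
  qed
qed

text \<open>Time reversal turns this into the nonnegative case: \<open>u (- s)\<close> satisfies the
  integrated equation with \<open>- g (- s)\<close> and \<open>- h (- s)\<close>. The reflected
  interval \<open>{- b..- a}\<close> is the reason why the preceding lemma allows a general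
  interval.\<close>

lemma periodic_upper_bound_nonpos:
  fixes u g h :: "real \<Rightarrow> real"
  assumes u: "continuous_on {a..b} u" and per: "u a = u b"
    and g: "g absolutely_integrable_on {a..b}" and h: "h integrable_on {a..b}"
    and inc: "\<And>x y. a \<le> x \<Longrightarrow> x \<le> y \<Longrightarrow> y \<le> b \<Longrightarrow> u y - u x = integral {x..y} (\<lambda>s. g s - h s)"
    and barrier: "\<And>s. s \<in> {a..b} \<Longrightarrow> R \<le> u s \<Longrightarrow> h s \<le> 0"
    and t0: "t0 \<in> {a..b}" "u t0 \<le> R" and t: "t \<in> {a..b}"
  shows "u t \<le> R + integral {a..b} (\<lambda>s. \<bar>g s\<bar>)"
proof -
  have "u (- (- t)) \<le> R + integral {- b..- a} (\<lambda>s. \<bar>- g (- s)\<bar>)"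
  proof (rule periodic_upper_bound_nonneg[where u = "\<lambda>s. u (- s)" and g = "\<lambda>s. - g (- s)"
        and h = "\<lambda>s. - h (- s)" and ?t0.0 = "- t0" and t = "- t"])
    show "continuous_on {- b..- a} (\<lambda>s. u (- s))"
      by (rule continuous_on_compose2[OF u]) (auto intro: continuous_intros)
    have "g integrable_on {a..b}" "(\<lambda>s. \<bar>g s\<bar>) integrable_on {a..b}"
      using g by (auto simp: absolutely_integrable_on_def)
    then have "(\<lambda>s. g (- s)) integrable_on {- b..- a}" "(\<lambda>s. \<bar>g (- s)\<bar>) integrable_on {- b..- a}"
      using Henstock_Kurzweil_Integration.integrable_reflect_real[where f = "\<lambda>s. \<bar>g s\<bar>" and a = a and b = b] by simp_all
    then show "(\<lambda>s. - g (- s)) absolutely_integrable_on {- b..- a}"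
      by (simp add: absolutely_integrable_on_def integrable_neg_iff)
    show "(\<lambda>s. - h (- s)) integrable_on {- b..- a}"
      using h by (simp add: integrable_neg_iff)
    show "u (- y) - u (- x) = integral {x..y} (\<lambda>s. - g (- s) - - h (- s))"
      if "- b \<le> x" "x \<le> y" "y \<le> - a" for x y
    proof -
      have "integral {x..y} (\<lambda>s. - g (- s) - - h (- s)) = integral {x..y} (\<lambda>s. - (\<lambda>r. g r - h r) (- s))"
        by simp
      also have "\<dots> = - integral {x..y} (\<lambda>s. g (- s) - h (- s))"
        by (rule integral_neg)
      also have "integral {x..y} (\<lambda>s. g (- s) - h (- s)) = integral {- y..- x} (\<lambda>r. g r - h r)"
        using Henstock_Kurzweil_Integration.integral_reflect_real[where a = "- y" and b = "- x" and f = "\<lambda>r. g r - h r"]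
        by simp
      also have "- integral {- y..- x} (\<lambda>r. g r - h r) = u (- y) - u (- x)"
        using inc[of "- y" "- x"] that by simp
      finally show ?thesis by simp
    qed
  qed (use per barrier t0 t in auto)
  also have "integral {- b..- a} (\<lambda>s. \<bar>- g (- s)\<bar>) = integral {a..b} (\<lambda>s. \<bar>g s\<bar>)"
    using Henstock_Kurzweil_Integration.integral_reflect_real[where a = a and b = b and f = "\<lambda>s. \<bar>g s\<bar>"] by simp
  finally show ?thesis by simp
qed

lemma periodic_upper_bound:
  fixes u g h :: "real \<Rightarrow> real"
  assumes u: "continuous_on {0..1} u" and per: "u 0 = u 1"
    and g: "g absolutely_integrable_on {0..1}" and h: "h integrable_on {0..1}"
    and inc: "\<And>x y. 0 \<le> x \<Longrightarrow> x \<le> y \<Longrightarrow> y \<le> 1 \<Longrightarrow> u y - u x = integral {x..y} (\<lambda>s. g s - h s)"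
    and M: "integral {0..1} (\<lambda>s. \<bar>g s\<bar>) \<le> M"
    and barrier: "(\<forall>s\<in>{0..1}. R \<le> u s \<longrightarrow> M + 1 \<le> h s) \<or> (\<forall>s\<in>{0..1}. R \<le> u s \<longrightarrow> h s \<le> - (M + 1))"
    and t: "t \<in> {0..1}"
  shows "u t \<le> R + M"
proof -
  have gi: "g integrable_on {0..1}" "(\<lambda>s. \<bar>g s\<bar>) integrable_on {0..1}"
    using g by (auto simp: absolutely_integrable_on_def)
  have g_le: "\<bar>integral {0..1} g\<bar> \<le> M"
    using integral_norm_bound_integral[OF gi] M by simp
  then have M0: "0 \<le> M" by linarith
  \<comment> \<open>Periodicity makes the integrals of \<open>g\<close> and \<open>h\<close> over
    the period equal. If \<open>u\<close> stayed above \<open>R\<close>, the integral of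
    \<open>h\<close> would be at least \<open>M + 1\<close> in absolute value, while that of
    \<open>g\<close> is at most \<open>M\<close>; the margin 1 gives the contradiction.\<close>
  have "\<exists>t0\<in>{0..1}. u t0 \<le> R"
  proof (rule ccontr)
    assume "\<not> ?thesis"
    then have above: "R \<le> u s" if "s \<in> {0..1}" for s using that by force
    have "integral {0..1} g - integral {0..1} h = integral {0..1} (\<lambda>s. g s - h s)"
      by (rule Henstock_Kurzweil_Integration.integral_diff[OF gi(1) h, symmetric])
    then have eq: "integral {0..1} h = integral {0..1} g" using inc[of 0 1] per by simp
    from barrier show False
    proof
      assume "\<forall>s\<in>{0..1}. R \<le> u s \<longrightarrow> M + 1 \<le> h s"
      then have "integral {0..1} (\<lambda>s::real. M + 1) \<le> integral {0..1} h"
        using above h by (intro integral_le) auto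
      then show False using eq g_le by simp
    next
      assume "\<forall>s\<in>{0..1}. R \<le> u s \<longrightarrow> h s \<le> - (M + 1)"
      then have "integral {0..1} h \<le> integral {0..1} (\<lambda>s::real. - (M + 1))"
        using above h by (intro integral_le) auto
      then show False using eq g_le by simp
    qed
  qed
  then obtain t0 where t0: "t0 \<in> {0..1}" "u t0 \<le> R" by blast
  from barrier have "u t \<le> R + integral {0..1} (\<lambda>s. \<bar>g s\<bar>)"
  proof
    assume b: "\<forall>s\<in>{0..1}. R \<le> u s \<longrightarrow> M + 1 \<le> h s"
    show ?thesis
      by (rule periodic_upper_bound_nonneg[OF u per g h inc _ t0 t]) (use b M0 in force)+
  next
    assume b: "\<forall>s\<in>{0..1}. R \<le> u s \<longrightarrow> h s \<le> - (M + 1)"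
    show ?thesis
      by (rule periodic_upper_bound_nonpos[OF u per g h inc _ t0 t]) (use b M0 in force)+
  qed
  then show ?thesis using M by simp
qed

text \<open>The lower bound is the upper bound for \<open>- u\<close>, with \<open>- g\<close> and
  \<open>- h\<close>; the change of sign swaps the two alternatives of \<open>below\<close>.\<close>

lemma periodic_bound:
  fixes u g h :: "real \<Rightarrow> real"
  assumes u: "continuous_on {0..1} u" and per: "u 0 = u 1"
    and g: "g absolutely_integrable_on {0..1}" and h: "h integrable_on {0..1}"
    and inc: "\<And>x y. 0 \<le> x \<Longrightarrow> x \<le> y \<Longrightarrow> y \<le> 1 \<Longrightarrow> u y - u x = integral {x..y} (\<lambda>s. g s - h s)"
    and M: "integral {0..1} (\<lambda>s. \<bar>g s\<bar>) \<le> M"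
    and above: "(\<forall>s\<in>{0..1}. R \<le> u s \<longrightarrow> M + 1 \<le> h s) \<or> (\<forall>s\<in>{0..1}. R \<le> u s \<longrightarrow> h s \<le> - (M + 1))"
    and below: "(\<forall>s\<in>{0..1}. u s \<le> - R \<longrightarrow> M + 1 \<le> h s) \<or> (\<forall>s\<in>{0..1}. u s \<le> - R \<longrightarrow> h s \<le> - (M + 1))"
    and t: "t \<in> {0..1}"
  shows "\<bar>u t\<bar> \<le> R + M"
proof -
  have "u t \<le> R + M" by (rule periodic_upper_bound[OF u per g h inc M above t])
  moreover have "- u t \<le> R + M"
  proof (rule periodic_upper_bound[where u = "\<lambda>s. - u s" and t = t and g = "\<lambda>s. - g s" and h = "\<lambda>s. - h s"])
    show "- u y - - u x = integral {x..y} (\<lambda>s. - g s - - h s)" if "0 \<le> x" "x \<le> y" "y \<le> 1" for x y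
    proof -
      have "integral {x..y} (\<lambda>s. - g s - - h s) = integral {x..y} (\<lambda>s. - (g s - h s))" by simp
      also have "\<dots> = - (u y - u x)" using inc[OF that] by (simp only: integral_neg)
      finally show ?thesis by simp
    qed
    have "R \<le> - u s \<longleftrightarrow> u s \<le> - R" for s by auto
    moreover have "M + 1 \<le> - h s \<longleftrightarrow> h s \<le> - (M + 1)" "- h s \<le> - (M + 1) \<longleftrightarrow> M + 1 \<le> h s" for s by auto
    ultimately show "(\<forall>s\<in>{0..1}. R \<le> - u s \<longrightarrow> M + 1 \<le> - h s) \<or> (\<forall>s\<in>{0..1}. R \<le> - u s \<longrightarrow> - h s \<le> - (M + 1))"
      using below by simp blast
  qed (use u per g h M t in \<open>auto intro!: continuous_intros simp: absolutely_integrable_on_def integrable_neg_iff\<close>)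
  ultimately show ?thesis by simp
qed

section \<open>Bounds from properness of the nonlinearity\<close>

lemma compact_real_bounded:
  fixes S :: "real set"
  assumes "compact S"
  obtains B where "\<And>y. y \<in> S \<Longrightarrow> \<bar>y\<bar> \<le> B"
  using compact_imp_bounded[OF assms] that by (auto simp: bounded_iff)

text \<open>The preimage of \<open>{- M..M}\<close> is compact, so its projection to the line is
  bounded.\<close>

lemma proper_bound:
  fixes f :: "circle \<times> real \<Rightarrow> real"
  assumes "proper f"
  obtains R where "\<And>t x. R \<le> \<bar>x\<bar> \<Longrightarrow> M \<le> \<bar>f (t, x)\<bar>"
proof -
  have "compact (snd ` (f -` {- M..M}))"
    using assms by (intro compact_continuous_image continuous_intros) (auto simp: proper_def)
  then obtain B where B: "\<And>y. y \<in> snd ` (f -` {- M..M}) \<Longrightarrow> \<bar>y\<bar> \<le> B"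
    using compact_real_bounded by blast
  show thesis
  proof (rule that)
    fix t x assume x: "B + 1 \<le> \<bar>x\<bar>"
    show "M \<le> \<bar>f (t, x)\<bar>"
    proof (rule ccontr)
      assume "\<not> ?thesis"
      then have "(t, x) \<in> f -` {- M..M}" by auto
      then have "x \<in> snd ` (f -` {- M..M})" by force
      then show False using B x by force
    qed
  qed
qed

lemma continuous_lift:
  assumes "continuous_on UNIV f"
  shows "continuous_on A (\<lambda>(s, x). f (to_circle s, x))"
  unfolding case_prod_unfold
  by (intro continuous_on_compose2[OF assms] continuous_intros
      continuous_on_compose2[OF continuous_on_to_circle]) auto

text \<open>A change of sign would produce a zero by the intermediate value property.\<close>

lemma connected_bounded_away_from_zero:
  fixes F :: "'a::topological_space \<Rightarrow> real"
  assumes "connected S" "continuous_on S F" "0 < M" "\<And>z. z \<in> S \<Longrightarrow> M \<le> \<bar>F z\<bar>"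
  shows "(\<forall>z\<in>S. M \<le> F z) \<or> (\<forall>z\<in>S. F z \<le> - M)"
proof (rule ccontr)
  assume "\<not> ?thesis"
  then obtain y z where yz: "y \<in> S" "\<not> M \<le> F y" "z \<in> S" "\<not> F z \<le> - M" by blast
  then have "F y \<le> - M" "M \<le> F z" using assms(4)[of y] assms(4)[of z] by linarith+
  moreover have "connected (F ` S)" by (rule connected_continuous_image[OF assms(2,1)])
  ultimately have "0 \<in> F ` S"
    using yz assms(3) by (intro connectedD_interval[of "F ` S" "F y" "F z" 0]) auto
  then show False using assms(3,4) by force
qed

text \<open>The bound \<open>R + M\<close> depends on \<open>f\<close> and \<open>M\<close> alone,
  not on \<open>u\<close> or \<open>g\<close>. Here \<open>R\<close> belongs to the level
  \<open>M + 1\<close>, which supplies the margin needed in \<open>periodic_bound\<close>.\<close>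

lemma a_priori_bound:
  fixes f :: "circle \<times> real \<Rightarrow> real"
  assumes f: "proper f" and M0: "0 \<le> M"
  obtains B where "\<And>u g t. circle_primitive u (\<lambda>t. g t - f (t, apply_bcontfun u t)) \<Longrightarrow>
      integrable circle_measure g \<Longrightarrow> (LINT t|circle_measure. \<bar>g t\<bar>) \<le> M \<Longrightarrow> \<bar>apply_bcontfun u t\<bar> \<le> B"
proof -
  have fc: "continuous_on UNIV f" using f by (simp add: proper_def)
  obtain R where R: "\<And>t x. R \<le> \<bar>x\<bar> \<Longrightarrow> M + 1 \<le> \<bar>f (t, x)\<bar>"
    using proper_bound[OF f, of "M + 1"] by blast
  define F where "F s x = f (to_circle s, x)" for s x
  \<comment> \<open>The strips are taken over the unit interval instead of the circle, so that
    connectedness follows from convexity.\<close>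
  have sign: "(\<forall>z\<in>{0..1} \<times> X. M + 1 \<le> case_prod F z) \<or> (\<forall>z\<in>{0..1} \<times> X. case_prod F z \<le> - (M + 1))"
    if "convex X" "\<And>x. x \<in> X \<Longrightarrow> R \<le> \<bar>x\<bar>" for X
  proof (rule connected_bounded_away_from_zero)
    show "connected ({0..1::real} \<times> X)"
      by (intro convex_connected convex_Times that) simp
    show "continuous_on ({0..1} \<times> X) (case_prod F)"
      unfolding F_def by (rule continuous_lift[OF fc])
  qed (use that(2) R M0 in \<open>auto simp: F_def\<close>)
  have above: "(\<forall>z\<in>{0..1} \<times> {R..}. M + 1 \<le> case_prod F z) \<or> (\<forall>z\<in>{0..1} \<times> {R..}. case_prod F z \<le> - (M + 1))"
    by (rule sign) auto
  have below: "(\<forall>z\<in>{0..1} \<times> {..-R}. M + 1 \<le> case_prod F z) \<or> (\<forall>z\<in>{0..1} \<times> {..-R}. case_prod F z \<le> - (M + 1))"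
    by (rule sign) auto
  show thesis
  proof (rule that)
    fix u g t
    assume prim: "circle_primitive u (\<lambda>t. g t - f (t, apply_bcontfun u t))"
      and gi: "integrable circle_measure g" and gM: "(LINT t|circle_measure. \<bar>g t\<bar>) \<le> M"
    define U where "U s = apply_bcontfun u (to_circle s)" for s
    have Uc: "continuous_on A U" for A
      unfolding U_def by (rule continuous_on_compose2[OF _ continuous_on_subset[OF continuous_on_to_circle]]) auto
    have hc: "continuous_on {0..1} (\<lambda>s. F s (U s))"
      using continuous_on_compose2[OF continuous_lift[OF fc], of "{0..1}" "\<lambda>s. (s, U s)" UNIV] Uc
      by (simp add: F_def continuous_on_Pair)
    have bd: "\<bar>U s\<bar> \<le> R + M" if s: "s \<in> {0..1}" for s
    proof (rule periodic_bound[OF Uc])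
      show "U 0 = U 1" by (simp add: U_def to_circle_1)
      show "(\<lambda>s. g (to_circle s)) absolutely_integrable_on {0..1}"
        by (rule circle_absolutely_integrable[OF gi])
      show "(\<lambda>s. F s (U s)) integrable_on {0..1}"
        by (rule integrable_continuous_interval[OF hc])
      show "U y - U x = integral {x..y} (\<lambda>s. g (to_circle s) - F s (U s))" if "0 \<le> x" "x \<le> y" "y \<le> 1" for x y
        using prim that by (simp add: circle_primitive_def U_def F_def)
      show "integral {0..1} (\<lambda>s. \<bar>g (to_circle s)\<bar>) \<le> M"
        using circle_integral_eq[OF integrable_abs[OF gi]] gM by simp
      show "(\<forall>s\<in>{0..1}. R \<le> U s \<longrightarrow> M + 1 \<le> F s (U s)) \<or> (\<forall>s\<in>{0..1}. R \<le> U s \<longrightarrow> F s (U s) \<le> - (M + 1))"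
        using above by auto
      show "(\<forall>s\<in>{0..1}. U s \<le> - R \<longrightarrow> M + 1 \<le> F s (U s)) \<or> (\<forall>s\<in>{0..1}. U s \<le> - R \<longrightarrow> F s (U s) \<le> - (M + 1))"
        using below by auto
    qed (rule s)
    show "\<bar>apply_bcontfun u t\<bar> \<le> R + M"
      by (rule to_circle_unit_interval[of t]) (use bd in \<open>auto simp: U_def\<close>)
  qed
qed

text \<open>The compactness step shared by both cases: convergence of \<open>g n\<close> in C^0 or
  in L^2 implies the convergence in L^1 assumed here.\<close>

lemma primitive_sequence_compact:
  fixes f :: "circle \<times> real \<Rightarrow> real" and u :: "nat \<Rightarrow> C0_circle"
  assumes f: "proper f"
    and prim: "\<And>n. circle_primitive (u n) (\<lambda>t. g n t - f (t, apply_bcontfun (u n) t))"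
    and gi: "\<And>n. integrable circle_measure (g n)" and Gi: "integrable circle_measure G"
    and lim: "(\<lambda>n. LINT t|circle_measure. \<bar>g n t - G t\<bar>) \<longlonglongrightarrow> 0"
  obtains v k where "strict_mono (k :: nat \<Rightarrow> nat)" "(u \<circ> k) \<longlonglongrightarrow> v"
proof -
  have fc: "continuous_on UNIV f" using f by (simp add: proper_def)
  \<comment> \<open>A convergent sequence is bounded, so a single \<open>M\<close> bounds the L^1
    norms of all \<open>g n\<close> and a single \<open>B\<close> bounds all
    \<open>u n\<close>.\<close>
  have "Bseq (\<lambda>n. LINT t|circle_measure. \<bar>g n t - G t\<bar>)"
    using lim by (intro convergent_imp_Bseq convergentI)
  then obtain K where K: "\<And>n. norm (LINT t|circle_measure. \<bar>g n t - G t\<bar>) \<le> K"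
    by (auto simp: Bseq_def)
  define M where "M = K + (LINT t|circle_measure. \<bar>G t\<bar>)"
  have gM: "(LINT t|circle_measure. \<bar>g n t\<bar>) \<le> M" for n
  proof -
    have "(LINT t|circle_measure. \<bar>g n t\<bar>) \<le> (LINT t|circle_measure. \<bar>g n t - G t\<bar> + \<bar>G t\<bar>)"
      by (rule integral_mono) (use gi Gi in auto)
    also have "\<dots> = (LINT t|circle_measure. \<bar>g n t - G t\<bar>) + (LINT t|circle_measure. \<bar>G t\<bar>)"
      using gi Gi by (intro Bochner_Integration.integral_add) auto
    also have "\<dots> \<le> M" using K[of n] by (simp add: M_def)
    finally show ?thesis .
  qed
  have "0 \<le> (LINT t|circle_measure. \<bar>g 0 t\<bar>)" by simp
  then have M0: "0 \<le> M" using gM[of 0] by linarith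
  obtain B where B: "\<And>n t. \<bar>apply_bcontfun (u n) t\<bar> \<le> B"
    using a_priori_bound[OF f M0] prim gi gM by metis
  have "compact (f ` (UNIV \<times> {- B..B}))"
    by (intro compact_continuous_image continuous_on_subset[OF fc] compact_Times compact_circle) auto
  then obtain C where C: "\<And>y. y \<in> f ` (UNIV \<times> {- B..B}) \<Longrightarrow> \<bar>y\<bar> \<le> C"
    using compact_real_bounded by blast
  have fC: "\<bar>f (t, apply_bcontfun (u n) t)\<bar> \<le> C" for n t
  proof (rule C, rule image_eqI)
    show "(t, apply_bcontfun (u n) t) \<in> UNIV \<times> {- B..B}"
      using B[of n t] by auto
  qed simp
  then have C0: "0 \<le> C" using abs_ge_zero order_trans by blast
  define x where "x n s = g n (to_circle s)" for n s
  define X where "X s = G (to_circle s)" for s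
  define U where "U n s = apply_bcontfun (u n) (to_circle s)" for n s
  \<comment> \<open>Subtracting the primitive of the integrable part leaves only the integral of
    \<open>- f (t, u n t)\<close>, whose integrand is bounded by \<open>C\<close>; hence the
    Lipschitz estimate uniform in \<open>n\<close>.\<close>
  define p where "p n s = U n s - integral {0..s} (x n)" for n s
  have x_ai: "x n absolutely_integrable_on {0..1}" for n
    using circle_absolutely_integrable[OF gi[of n]] by (simp add: x_def[abs_def])
  have X_ai: "X absolutely_integrable_on {0..1}"
    using circle_absolutely_integrable[OF Gi] by (simp add: X_def[abs_def])
  have xi: "x n integrable_on {a..b}" "(\<lambda>s. \<bar>x n s\<bar>) integrable_on {a..b}"
      "X integrable_on {a..b}"
    if "0 \<le> a" "b \<le> 1" for a b n
  proof -
    have "x n absolutely_integrable_on {a..b}"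
      by (rule absolutely_integrable_on_subinterval[OF x_ai]) (use that in auto)
    moreover have "X absolutely_integrable_on {a..b}"
      by (rule absolutely_integrable_on_subinterval[OF X_ai]) (use that in auto)
    ultimately show "x n integrable_on {a..b}" "(\<lambda>s. \<bar>x n s\<bar>) integrable_on {a..b}"
      "X integrable_on {a..b}"
      by (auto simp: absolutely_integrable_on_def)
  qed
  have int_x: "\<bar>integral {0..s} (x n)\<bar> \<le> M" if s: "s \<in> {0..1}" for s n
  proof -
    have "\<bar>integral {0..s} (x n)\<bar> \<le> integral {0..s} (\<lambda>r. \<bar>x n r\<bar>)"
      using integral_norm_bound_integral[of "x n" "{0..s}" "\<lambda>r. \<bar>x n r\<bar>"] xi s by simp
    also have "\<dots> \<le> integral {0..1} (\<lambda>r. \<bar>x n r\<bar>)"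
      by (rule integral_subset_le) (use xi s in auto)
    also have "\<dots> \<le> M"
      using gM[of n] circle_integral_eq[OF integrable_abs[OF gi[of n]]] by (simp add: x_def)
    finally show ?thesis .
  qed
  have int_diff: "\<bar>integral {0..s} (x n) - integral {0..s} X\<bar> \<le> (LINT t|circle_measure. \<bar>g n t - G t\<bar>)"
    if s: "s \<in> {0..1}" for s n
    using circle_integral_diff_le[OF gi[of n] Gi, of 0 s] s by (simp add: x_def[abs_def] X_def[abs_def])
  have lip: "\<bar>p n b - p n a\<bar> \<le> C * (b - a)" if ab: "0 \<le> a" "a \<le> b" "b \<le> 1" for n a b
  proof -
    define h where "h s = f (to_circle s, U n s)" for s
    have v: "(\<lambda>s. x n s - h s) absolutely_integrable_on {0..1}"
      and inc: "U n b - U n a = integral {a..b} (\<lambda>s. x n s - h s)"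
      using prim[of n] ab by (auto simp: circle_primitive_def U_def x_def h_def)
    have vi: "(\<lambda>s. x n s - h s) integrable_on {a..b}"
      using absolutely_integrable_on_subinterval[OF v, of a b] ab by (auto simp: absolutely_integrable_on_def)
    have hi: "(\<lambda>s. x n s - (x n s - h s)) integrable_on {a..b}"
      by (rule Henstock_Kurzweil_Integration.integrable_diff[OF xi(1)[of a b n, OF ab(1,3)] vi])
    have "integral {0..a} (x n) + integral {a..b} (x n) = integral {0..b} (x n)"
      using ab xi by (intro Henstock_Kurzweil_Integration.integral_combine) auto
    then have "p n b - p n a = integral {a..b} (\<lambda>s. x n s - h s) - integral {a..b} (x n)"
      using inc by (simp add: p_def)
    also have "\<dots> = - (integral {a..b} (\<lambda>s. x n s - (x n s - h s)))"
      using Henstock_Kurzweil_Integration.integral_diff[OF xi(1)[of a b n, OF ab(1,3)] vi] by simp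
    finally have "\<bar>p n b - p n a\<bar> = \<bar>integral {a..b} h\<bar>" by simp
    also have "\<dots> \<le> integral {a..b} (\<lambda>s. C)"
    proof -
      have "h integrable_on {a..b}" using hi by simp
      moreover have "(\<lambda>s. C) integrable_on {a..b}" by (rule integrable_const_ivl)
      moreover have "norm (h s) \<le> C" for s using fC[of "to_circle s" n] by (simp add: h_def U_def)
      ultimately have "norm (integral {a..b} h) \<le> integral {a..b} (\<lambda>s. C)"
        by (rule integral_norm_bound_integral)
      then show ?thesis by simp
    qed
    also have "\<dots> = C * (b - a)" using ab by simp
    finally show ?thesis .
  qed
  have lip': "\<bar>p n b - p n a\<bar> \<le> C * \<bar>b - a\<bar>" if "a \<in> {0..1}" "b \<in> {0..1}" for n a b
    using lip[of a b n] lip[of b a n] that by (cases "a \<le> b") (auto simp: abs_minus_commute)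
  obtain q k where k: "strict_mono (k :: nat \<Rightarrow> nat)" and qc: "continuous_on {0..1} q"
    and q: "\<And>e. 0 < e \<Longrightarrow> \<exists>N. \<forall>n s. n \<ge> N \<and> s \<in> {0..1} \<longrightarrow> norm (p (k n) s - q s) < e"
  proof (rule Arzela_Ascoli[of "{0..1::real}" p "B + M"])
    show "norm (p n s) \<le> B + M" if "s \<in> {0..1}" for n s
      using B[of n "to_circle s"] int_x[OF that, of n] by (simp add: p_def U_def)
    show "\<exists>d>0. \<forall>n y. y \<in> {0..1} \<and> norm (s - y) < d \<longrightarrow> norm (p n s - p n y) < e"
      if s: "s \<in> {0..1}" and e: "0 < e" for s e
    proof (intro exI conjI allI impI)
      \<comment> \<open>The added 1 covers \<open>C = 0\<close>.\<close>
      show "0 < e / (C + 1)" using e C0 by simp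
      fix n y assume y: "y \<in> {0..1} \<and> norm (s - y) < e / (C + 1)"
      have "\<bar>p n s - p n y\<bar> \<le> C * \<bar>s - y\<bar>" using lip' s y by blast
      also have "\<dots> \<le> (C + 1) * \<bar>s - y\<bar>" by (intro mult_right_mono) auto
      also have "\<dots> < (C + 1) * (e / (C + 1))" using y C0 by (intro mult_strict_left_mono) auto
      also have "\<dots> = e" using C0 by simp
      finally show "norm (p n s - p n y) < e" by simp
    qed
  qed auto
  \<comment> \<open>The limit has the primitive of \<open>G\<close> added back, since the primitives
    of \<open>g n\<close> converge uniformly to it.\<close>
  define Q where "Q s = q s + integral {0..s} X" for s
  have Qc: "continuous_on {0..1} Q"
    unfolding Q_def using xi(3)[of 0 1]
    by (intro continuous_intros qc indefinite_integral_continuous_1) auto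
  have close: "\<bar>U (k n) s - Q s\<bar> \<le> \<bar>p (k n) s - q s\<bar> + (LINT t|circle_measure. \<bar>g (k n) t - G t\<bar>)"
    if "s \<in> {0..1}" for n s
    using int_diff[OF that, of "k n"] by (simp add: p_def Q_def)
  have lim_k: "(\<lambda>n. LINT t|circle_measure. \<bar>g (k n) t - G t\<bar>) \<longlonglongrightarrow> 0"
    using LIMSEQ_subseq_LIMSEQ[OF lim k] by (simp add: o_def)
  have unif: "\<exists>N. \<forall>n\<ge>N. \<forall>s\<in>{0..1}. \<bar>U (k n) s - Q s\<bar> < e" if e: "0 < e" for e
  proof -
    obtain N1 where N1: "\<And>n s. n \<ge> N1 \<Longrightarrow> s \<in> {0..1} \<Longrightarrow> \<bar>p (k n) s - q s\<bar> < e / 2"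
      using q[of "e / 2"] e by auto
    obtain N2 where N2: "\<And>n. n \<ge> N2 \<Longrightarrow> \<bar>LINT t|circle_measure. \<bar>g (k n) t - G t\<bar>\<bar> < e / 2"
      using LIMSEQ_D[OF lim_k, of "e / 2"] e by auto
    have "\<bar>U (k n) s - Q s\<bar> < e" if "n \<ge> max N1 N2" "s \<in> {0..1}" for n s
      using close[OF that(2), of n] N1[of n s] N2[of n] that by auto
    then show ?thesis by blast
  qed
  have U_lim: "(\<lambda>n. U (k n) s) \<longlonglongrightarrow> Q s" if "s \<in> {0..1}" for s
    using unif that by (intro LIMSEQ_I) fastforce
  \<comment> \<open>Arzela-Ascoli is applied on the unit interval, so equality at the endpoints has
    to be passed to the limit before \<open>Q\<close> descends to the circle.\<close>
  have "U n 0 = U n 1" for n by (simp add: U_def to_circle_1)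
  then have "Q 0 = Q 1"
    using U_lim[of 0] U_lim[of 1] LIMSEQ_unique by auto
  then obtain v :: C0_circle where v: "\<And>s. s \<in> {0..1} \<Longrightarrow> apply_bcontfun v (to_circle s) = Q s"
    using descend_to_circle[OF Qc] by blast
  have "(u \<circ> k) \<longlonglongrightarrow> v"
  proof (rule metric_LIMSEQ_I)
    fix e :: real assume e: "0 < e"
    obtain N where N: "\<And>n s. n \<ge> N \<Longrightarrow> s \<in> {0..1} \<Longrightarrow> \<bar>U (k n) s - Q s\<bar> < e / 2"
      using unif[of "e / 2"] e half_gt_zero by blast
    have "dist ((u \<circ> k) n) v < e" if n: "n \<ge> N" for n
    proof -
      have "dist ((u \<circ> k) n) v \<le> e / 2"
      proof (rule dist_bound)
        fix t
        obtain s where s: "s \<in> {0..<1}" "t = to_circle s" by (rule to_circle_unit_interval)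
        then show "dist (apply_bcontfun ((u \<circ> k) n) t) (apply_bcontfun v t) \<le> e / 2"
          using N[OF n, of s] v[of s] by (simp add: dist_real_def U_def less_imp_le)
      qed
      then show ?thesis using e by simp
    qed
    then show "\<exists>N. \<forall>n\<ge>N. dist ((u \<circ> k) n) v < e" by blast
  qed
  then show thesis by (rule that[OF k])
qed

section \<open>Superposition operators\<close>

text \<open>The Nemytskii operator of \<open>f\<close> on C^0.\<close>

definition superposition :: "(circle \<times> real \<Rightarrow> real) \<Rightarrow> C0_circle \<Rightarrow> C0_circle" where
  "superposition f u = Bcontfun (\<lambda>t. f (t, apply_bcontfun u t))"

lemma superposition_bcontfun:
  fixes f :: "circle \<times> real \<Rightarrow> real"
  assumes "continuous_on UNIV f"
  shows "(\<lambda>t. f (t, apply_bcontfun u t)) \<in> bcontfun"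
  by (intro continuous_bcontfun_circle continuous_on_compose2[OF assms] continuous_intros) auto

lemma apply_superposition:
  "continuous_on UNIV f \<Longrightarrow> apply_bcontfun (superposition f u) t = f (t, apply_bcontfun u t)"
  unfolding superposition_def by (simp add: Bcontfun_inverse superposition_bcontfun)

text \<open>Near \<open>v\<close> all values lie in a fixed compact strip, on which \<open>f\<close>
  is uniformly continuous. The lift \<open>?F\<close> is used because \<open>circle\<close> is given
  a topology but no metric.\<close>

lemma superposition_tendsto:
  fixes u :: "nat \<Rightarrow> C0_circle"
  assumes f: "continuous_on UNIV f" and u: "u \<longlonglongrightarrow> v"
  shows "(\<lambda>n. superposition f (u n)) \<longlonglongrightarrow> superposition f v"
proof (rule metric_LIMSEQ_I)
  fix e :: real assume e: "0 < e"
  define R where "R = norm v + 1"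
  let ?F = "\<lambda>(s, x). f (to_circle s, x)"
  have "uniformly_continuous_on ({0..1} \<times> {- R..R}) ?F"
    by (intro compact_uniformly_continuous continuous_lift f compact_Times) auto
  then obtain d where d: "0 < d"
    and dF: "\<And>z z'. z \<in> {0..1} \<times> {- R..R} \<Longrightarrow> z' \<in> {0..1} \<times> {- R..R} \<Longrightarrow> dist z' z < d \<Longrightarrow> dist (?F z') (?F z) < e / 2"
    unfolding uniformly_continuous_on_def using e by (metis half_gt_zero)
  \<comment> \<open>The bound 1 keeps the values of \<open>u n\<close> within
    \<open>R = norm v + 1\<close>; the bound \<open>d\<close> is the modulus of uniform
    continuity.\<close>
  obtain N where N: "\<And>n. n \<ge> N \<Longrightarrow> dist (u n) v < min 1 d"
    using metric_LIMSEQ_D[OF u, of "min 1 d"] d by auto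
  have "dist (superposition f (u n)) (superposition f v) < e" if n: "n \<ge> N" for n
  proof -
    have "dist (superposition f (u n)) (superposition f v) \<le> e / 2"
    proof (rule dist_bound)
      fix t
      obtain s where s: "s \<in> {0..<1}" "t = to_circle s" by (rule to_circle_unit_interval)
      have uv: "\<bar>apply_bcontfun (u n) t - apply_bcontfun v t\<bar> < min 1 d"
        using dist_bounded[of "u n" t v] N[OF n] by (simp add: dist_real_def)
      have "\<bar>apply_bcontfun v t\<bar> \<le> norm v" using norm_bounded[of v t] by simp
      then have "(s, apply_bcontfun (u n) t) \<in> {0..1} \<times> {- R..R}" "(s, apply_bcontfun v t) \<in> {0..1} \<times> {- R..R}"
        using uv s by (auto simp: R_def)
      moreover have "dist (s, apply_bcontfun (u n) t) (s, apply_bcontfun v t) < d"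
        using uv by (simp add: dist_Pair_Pair dist_real_def)
      ultimately have "dist (?F (s, apply_bcontfun (u n) t)) (?F (s, apply_bcontfun v t)) < e / 2"
        by (intro dF)
      then show "dist (apply_bcontfun (superposition f (u n)) t) (apply_bcontfun (superposition f v) t) \<le> e / 2"
        using s by (simp add: apply_superposition[OF f])
    qed
    then show ?thesis using e by simp
  qed
  then show "\<exists>N. \<forall>n\<ge>N. dist (superposition f (u n)) (superposition f v) < e" by blast
qed

text \<open>In metric spaces compactness is sequential. Given a sequence in the preimage of
  \<open>K\<close>, first its images are made convergent in \<open>K\<close>, then
  \<open>comp\<close> gives a convergent subsequence, and continuity places its limit in the
  preimage.\<close>

lemma proper_sequentialI:
  fixes g :: "'a::metric_space \<Rightarrow> 'b::metric_space"
  assumes cont: "\<And>x l. x \<longlonglongrightarrow> l \<Longrightarrow> (\<lambda>n::nat. g (x n)) \<longlonglongrightarrow> g l"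
    and comp: "\<And>x y. (\<lambda>n::nat. g (x n)) \<longlonglongrightarrow> y \<Longrightarrow> \<exists>k l. strict_mono k \<and> (x \<circ> k) \<longlonglongrightarrow> l"
  shows "proper g"
  unfolding proper_def
proof (intro conjI allI impI)
  show "continuous_on UNIV g"
    unfolding continuous_on_sequentially using cont by (simp add: o_def)
  fix K :: "'b set" assume "compact K"
  then have K: "seq_compact K" by (simp add: compact_eq_seq_compact_metric)
  show "compact (g -` K)"
    unfolding compact_eq_seq_compact_metric
  proof (rule seq_compactI)
    fix x :: "nat \<Rightarrow> 'a" assume "\<forall>n. x n \<in> g -` K"
    then have "\<forall>n. (g \<circ> x) n \<in> K" by simp
    then obtain y r where y: "y \<in> K" and r: "strict_mono r" and lim: "((g \<circ> x) \<circ> r) \<longlonglongrightarrow> y"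
      using K unfolding seq_compact_def by blast
    have "(\<lambda>n. g ((x \<circ> r) n)) \<longlonglongrightarrow> y" using lim by (simp add: o_def)
    then obtain k l where k: "strict_mono k" and l: "((x \<circ> r) \<circ> k) \<longlonglongrightarrow> l"
      using comp by blast
    have "(\<lambda>n. g (((x \<circ> r) \<circ> k) n)) \<longlonglongrightarrow> g l" by (rule cont[OF l])
    moreover have "(((g \<circ> x) \<circ> r) \<circ> k) \<longlonglongrightarrow> y" by (rule LIMSEQ_subseq_LIMSEQ[OF lim k])
    ultimately have "g l = y" by (intro LIMSEQ_unique[of _ "g l" y]) (simp_all add: o_def)
    then show "\<exists>l\<in>g -` K. \<exists>r. strict_mono r \<and> (x \<circ> r) \<longlonglongrightarrow> l"
      using y l k r by (intro bexI[of _ l] exI[of _ "r \<circ> k"]) (auto simp: o_assoc strict_mono_o)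
  qed
qed

section \<open>The operator on continuously differentiable functions\<close>

lemma C1_tendsto_iff:
  fixes u :: "nat \<Rightarrow> C1_circle"
  shows "u \<longlonglongrightarrow> v \<longleftrightarrow> (\<lambda>n. C1_to_C0 (u n)) \<longlonglongrightarrow> C1_to_C0 v \<and> (\<lambda>n. C1_deriv (u n)) \<longlonglongrightarrow> C1_deriv v"
proof
  assume "u \<longlonglongrightarrow> v"
  then have lim: "(\<lambda>n. dist (u n) v) \<longlonglongrightarrow> 0" by (simp add: tendsto_dist_iff[symmetric])
  have "(\<lambda>n. dist (C1_to_C0 (u n)) (C1_to_C0 v)) \<longlonglongrightarrow> 0"
    by (rule tendsto_sandwich[OF _ _ tendsto_const lim]) (simp_all add: dist_C1_circle_def)
  moreover have "(\<lambda>n. dist (C1_deriv (u n)) (C1_deriv v)) \<longlonglongrightarrow> 0"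
    by (rule tendsto_sandwich[OF _ _ tendsto_const lim]) (simp_all add: dist_C1_circle_def)
  ultimately show "(\<lambda>n. C1_to_C0 (u n)) \<longlonglongrightarrow> C1_to_C0 v \<and> (\<lambda>n. C1_deriv (u n)) \<longlonglongrightarrow> C1_deriv v"
    by (simp add: tendsto_dist_iff[symmetric])
next
  assume "(\<lambda>n. C1_to_C0 (u n)) \<longlonglongrightarrow> C1_to_C0 v \<and> (\<lambda>n. C1_deriv (u n)) \<longlonglongrightarrow> C1_deriv v"
  then have "(\<lambda>n. dist (C1_to_C0 (u n)) (C1_to_C0 v)) \<longlonglongrightarrow> 0" "(\<lambda>n. dist (C1_deriv (u n)) (C1_deriv v)) \<longlonglongrightarrow> 0"
    by (simp_all add: tendsto_dist_iff[symmetric])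
  from tendsto_add[OF this] have "(\<lambda>n. dist (u n) v) \<longlonglongrightarrow> 0" by (simp add: dist_C1_circle_def)
  then show "u \<longlonglongrightarrow> v" by (simp add: tendsto_dist_iff[symmetric])
qed

lemma circle_primitive_C1: "circle_primitive (C1_to_C0 u) (apply_bcontfun (C1_deriv u))"
  unfolding circle_primitive_def
proof (intro conjI allI impI)
  show "(\<lambda>s. apply_bcontfun (C1_deriv u) (to_circle s)) absolutely_integrable_on {0..1}"
    by (intro circle_absolutely_integrable integrable_continuous_circle) simp
  fix a b :: real assume "0 \<le> a" "a \<le> b" "b \<le> 1"
  have d: "((\<lambda>s. apply_bcontfun (C1_to_C0 u) (to_circle s)) has_vector_derivative
      apply_bcontfun (C1_deriv u) (to_circle s)) (at s within {a..b})" for s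
    using has_circle_derivative_C1_deriv[of u]
    unfolding has_circle_derivative_def has_real_derivative_iff_has_vector_derivative
    by (blast intro: has_vector_derivative_at_within)
  show "apply_bcontfun (C1_to_C0 u) (to_circle b) - apply_bcontfun (C1_to_C0 u) (to_circle a)
      = integral {a..b} (\<lambda>s. apply_bcontfun (C1_deriv u) (to_circle s))"
    using fundamental_theorem_of_calculus[OF \<open>a \<le> b\<close> d] by (simp add: integral_unique)
qed

text \<open>Differentiation is a closed operator: uniform convergence of the derivatives allows
  limit and derivative to be exchanged.\<close>

lemma C1_closed:
  assumes u: "(\<lambda>n. C1_to_C0 (u n)) \<longlonglongrightarrow> v" and u': "(\<lambda>n::nat. C1_deriv (u n)) \<longlonglongrightarrow> v'"
  obtains w where "C1_to_C0 w = v" "C1_deriv w = v'"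
proof -
  have pw: "(\<lambda>n. apply_bcontfun (C1_to_C0 (u n)) t) \<longlonglongrightarrow> apply_bcontfun v t" for t
  proof (rule metric_LIMSEQ_I)
    fix e :: real assume "0 < e"
    then obtain N where "\<And>n. n \<ge> N \<Longrightarrow> dist (C1_to_C0 (u n)) v < e"
      using metric_LIMSEQ_D[OF u] by blast
    then show "\<exists>N. \<forall>n\<ge>N. dist (apply_bcontfun (C1_to_C0 (u n)) t) (apply_bcontfun v t) < e"
      using dist_bounded le_less_trans by blast
  qed
  define P where "P n s = apply_bcontfun (C1_to_C0 (u n)) (to_circle s)" for n s
  have "\<exists>p. \<forall>s\<in>UNIV. (\<lambda>n. P n s) \<longlonglongrightarrow> p s \<and> (p has_derivative (\<lambda>h. apply_bcontfun v' (to_circle s) * h)) (at s within UNIV)"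
  proof (rule has_derivative_sequence[where f' = "\<lambda>n s h. apply_bcontfun (C1_deriv (u n)) (to_circle s) * h"])
    show "(P n has_derivative (\<lambda>h. apply_bcontfun (C1_deriv (u n)) (to_circle s) * h)) (at s within UNIV)" for n s
      using has_circle_derivative_C1_deriv[of "u n"]
      by (simp add: has_circle_derivative_def P_def[abs_def] has_field_derivative_def)
    show "(\<lambda>n. P n 0) \<longlonglongrightarrow> apply_bcontfun v (to_circle 0)"
      unfolding P_def by (rule pw)
    fix e :: real assume e: "0 < e"
    show "\<forall>\<^sub>F n in sequentially. \<forall>s\<in>UNIV. \<forall>h. norm (apply_bcontfun (C1_deriv (u n)) (to_circle s) * h
        - apply_bcontfun v' (to_circle s) * h) \<le> e * norm h"
      using tendstoD[OF u' e]
    proof eventually_elim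
      case (elim n)
      have "\<bar>apply_bcontfun (C1_deriv (u n)) (to_circle s) - apply_bcontfun v' (to_circle s)\<bar> \<le> e" for s
        using dist_bounded[of "C1_deriv (u n)" "to_circle s" v'] elim by (simp add: dist_real_def)
      then show ?case
        by (auto simp: abs_mult simp flip: left_diff_distrib intro!: mult_right_mono)
    qed
  qed auto
  then obtain p where p: "\<And>s. (\<lambda>n. P n s) \<longlonglongrightarrow> p s"
    and p': "\<And>s. (p has_derivative (\<lambda>h. apply_bcontfun v' (to_circle s) * h)) (at s)" by auto
  \<comment> \<open>The differentiable limit is only known to exist; pointwise convergence
    identifies it as the lift of \<open>v\<close>.\<close>
  have "p = (\<lambda>s. apply_bcontfun v (to_circle s))"
    using LIMSEQ_unique[OF p] pw unfolding P_def by blast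
  then have v': "has_circle_derivative (apply_bcontfun v) (apply_bcontfun v')"
    using p' by (simp add: has_circle_derivative_def has_field_derivative_def)
  then have w: "C1_to_C0 (Abs_C1_circle v) = v"
    by (intro Abs_C1_circle_inverse) auto
  have "C1_deriv (Abs_C1_circle v) = v'"
  proof (rule bcontfun_eqI)
    fix t
    obtain s where "t = to_circle s" by (rule to_circle_unit_interval)
    then show "apply_bcontfun (C1_deriv (Abs_C1_circle v)) t = apply_bcontfun v' t"
      using v' has_circle_derivative_C1_deriv[of "Abs_C1_circle v"] DERIV_unique
      unfolding w has_circle_derivative_def by blast
  qed
  with w show thesis by (rule that)
qed

lemma F_C_eq:
  assumes "continuous_on UNIV f"
  shows "F_C f u = C1_deriv u + superposition f (C1_to_C0 u)"
proof -
  have "(\<lambda>t. apply_bcontfun (C1_deriv u) t + f (t, apply_bcontfun (C1_to_C0 u) t))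
      = apply_bcontfun (C1_deriv u + superposition f (C1_to_C0 u))"
    by (simp add: fun_eq_iff plus_bcontfun.rep_eq apply_superposition[OF assms])
  then show ?thesis by (simp only: F_C_def apply_bcontfun_inverse)
qed

lemma integral_diff_le_dist:
  fixes v w :: C0_circle
  shows "(LINT t|circle_measure. \<bar>apply_bcontfun v t - apply_bcontfun w t\<bar>) \<le> dist v w"
proof -
  have "(LINT t|circle_measure. \<bar>apply_bcontfun v t - apply_bcontfun w t\<bar>) \<le> (LINT t|circle_measure. dist v w)"
  proof (rule integral_mono)
    show "integrable circle_measure (\<lambda>t. \<bar>apply_bcontfun v t - apply_bcontfun w t\<bar>)"
      by (intro integrable_continuous_circle continuous_intros) auto
  qed (use dist_bounded[of v _ w] in \<open>auto simp: dist_real_def\<close>)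
  then show ?thesis by simp
qed

text \<open>Once a subsequence converges uniformly, the equation solved for the derivative makes the
  derivatives converge uniformly too, and closedness puts the limit in C^1.\<close>

lemma proper_F_C:
  assumes f: "proper f"
  shows "proper (F_C f)"
proof (rule proper_sequentialI)
  have fc: "continuous_on UNIV f" using f by (simp add: proper_def)
  note eq = F_C_eq[OF fc]
  show "(\<lambda>n. F_C f (x n)) \<longlonglongrightarrow> F_C f l" if "x \<longlonglongrightarrow> l" for x :: "nat \<Rightarrow> C1_circle" and l
    unfolding eq using that by (intro tendsto_add superposition_tendsto fc) (simp_all add: C1_tendsto_iff)
  fix x :: "nat \<Rightarrow> C1_circle" and y
  assume y: "(\<lambda>n. F_C f (x n)) \<longlonglongrightarrow> y"
  have deriv: "C1_deriv (x n) = F_C f (x n) - superposition f (C1_to_C0 (x n))" for n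
    by (simp add: eq)
  obtain k v where k: "strict_mono (k :: nat \<Rightarrow> nat)" and v: "((\<lambda>n. C1_to_C0 (x n)) \<circ> k) \<longlonglongrightarrow> v"
  proof (rule primitive_sequence_compact[OF f])
    show "circle_primitive (C1_to_C0 (x n)) (\<lambda>t. apply_bcontfun (F_C f (x n)) t - f (t, apply_bcontfun (C1_to_C0 (x n)) t))" for n
      using circle_primitive_C1[of "x n"]
      by (simp add: deriv minus_bcontfun.rep_eq apply_superposition[OF fc])
    have lim: "(\<lambda>n. dist (F_C f (x n)) y) \<longlonglongrightarrow> 0" using y by (simp add: tendsto_dist_iff[symmetric])
    show "(\<lambda>n. LINT t|circle_measure. \<bar>apply_bcontfun (F_C f (x n)) t - apply_bcontfun y t\<bar>) \<longlonglongrightarrow> 0"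
      by (rule tendsto_sandwich[OF _ _ tendsto_const lim]) (simp_all add: integral_diff_le_dist)
  qed (auto intro: integrable_continuous_circle)
  have v': "(\<lambda>n. C1_to_C0 ((x \<circ> k) n)) \<longlonglongrightarrow> v" using v by (simp add: o_def)
  have "(\<lambda>n. F_C f (x (k n))) \<longlonglongrightarrow> y" using LIMSEQ_subseq_LIMSEQ[OF y k] by (simp add: o_def)
  then have "(\<lambda>n. C1_deriv ((x \<circ> k) n)) \<longlonglongrightarrow> y - superposition f v"
    unfolding o_def deriv using v' by (intro tendsto_diff superposition_tendsto fc) (simp_all add: o_def)
  moreover from v' this obtain w where "C1_to_C0 w = v" "C1_deriv w = y - superposition f v"
    by (rule C1_closed)
  ultimately have "(x \<circ> k) \<longlonglongrightarrow> w" using v' by (simp add: C1_tendsto_iff)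
  then show "\<exists>k l. strict_mono k \<and> (x \<circ> k) \<longlonglongrightarrow> l" using k by blast
qed

section \<open>The Lebesgue space\<close>

lemma square_integrable_rep_L2: "square_integrable (rep_L2 a)"
  using Quotient3_rep_reflp[OF Quotient3_L2_circle, of a] by (simp add: L2_rel_def)

lemma measurable_rep_L2 [measurable]: "rep_L2 a \<in> borel_measurable borel"
  using square_integrable_rep_L2[of a] by (simp add: square_integrable_def)

lemma rep_to_L2:
  assumes "square_integrable u"
  shows "AE t in circle_measure. rep_L2 (to_L2 u) t = u t"
proof -
  have "L2_rel (rep_L2 (to_L2 u)) u"
    using assms by (intro rep_abs_rsp_left[OF Quotient3_L2_circle]) (simp add: L2_rel_def)
  then show ?thesis by (simp add: L2_rel_def)
qed

lemma L2_eqI: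
  assumes "AE t in circle_measure. rep_L2 a t = rep_L2 b t"
  shows "a = b"
  using Quotient3_rel_rep[OF Quotient3_L2_circle, of a b] assms square_integrable_rep_L2
  by (simp add: L2_rel_def)

lemma dist_L2: "dist a b = sqrt (LINT t|circle_measure. (rep_L2 a t - rep_L2 b t)\<^sup>2)"
proof -
  have r: "L2_rel (rep_L2 c) (rep_L2 c)" for c by (rule Quotient3_rep_reflp[OF Quotient3_L2_circle])
  show ?thesis
    using dist_L2_circle.abs_eq[OF r r, of a b] by (simp add: Quotient3_abs_rep[OF Quotient3_L2_circle])
qed

text \<open>Cauchy-Schwarz against the constant 1, on a space of measure 1.\<close>

lemma L1_le_dist_L2: "(LINT t|circle_measure. \<bar>rep_L2 a t - rep_L2 b t\<bar>) \<le> dist a b"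
proof -
  have s: "square_integrable (\<lambda>t. rep_L2 a t - rep_L2 b t)"
    by (intro square_integrable_diff square_integrable_rep_L2)
  then have "square_integrable (\<lambda>t. \<bar>rep_L2 a t - rep_L2 b t\<bar>)"
    by (simp add: square_integrable_def)
  from L2_Cauchy_Schwarz[OF this square_integrable_continuous[of "\<lambda>_. 1"]]
  show ?thesis by (simp add: dist_L2)
qed

text \<open>The type \<open>L2_circle\<close> is given only a metric here, so the one sum needed to
  express \<open>F_H\<close>, of a class and a continuous function, is introduced
  separately.\<close>

definition L2_add :: "L2_circle \<Rightarrow> C0_circle \<Rightarrow> L2_circle" where
  "L2_add a h = to_L2 (\<lambda>t. rep_L2 a t + apply_bcontfun h t)"

lemma square_integrable_add_continuous:
  fixes h :: C0_circle
  assumes "square_integrable u"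
  shows "square_integrable (\<lambda>t. u t + apply_bcontfun h t)"
proof -
  have "square_integrable (apply_bcontfun (- h))"
    by (intro square_integrable_continuous) (auto simp: uminus_bcontfun.rep_eq intro!: continuous_intros)
  from square_integrable_diff[OF assms this] show ?thesis by (simp add: uminus_bcontfun.rep_eq)
qed

lemma rep_L2_add: "AE t in circle_measure. rep_L2 (L2_add a h) t = rep_L2 a t + apply_bcontfun h t"
  unfolding L2_add_def
  by (intro rep_to_L2 square_integrable_add_continuous square_integrable_rep_L2)

lemma dist_L2_cong_AE:
  assumes "AE t in circle_measure. rep_L2 a t - rep_L2 b t = d t" "d \<in> borel_measurable borel"
  shows "dist a b = sqrt (LINT t|circle_measure. (d t)\<^sup>2)"
proof -
  have "(LINT t|circle_measure. (rep_L2 a t - rep_L2 b t)\<^sup>2) = (LINT t|circle_measure. (d t)\<^sup>2)"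
    using assms by (intro integral_cong_AE) auto
  then show ?thesis by (simp add: dist_L2)
qed

lemma sqrt_integral_square_diff_le_dist:
  fixes h k :: C0_circle
  shows "sqrt (LINT t|circle_measure. (apply_bcontfun h t - apply_bcontfun k t)\<^sup>2) \<le> dist h k"
proof -
  have "(LINT t|circle_measure. (apply_bcontfun h t - apply_bcontfun k t)\<^sup>2) \<le> (LINT t|circle_measure. (dist h k)\<^sup>2)"
  proof (rule integral_mono)
    show "integrable circle_measure (\<lambda>t. (apply_bcontfun h t - apply_bcontfun k t)\<^sup>2)"
      by (intro integrable_continuous_circle continuous_intros) auto
    show "(apply_bcontfun h t - apply_bcontfun k t)\<^sup>2 \<le> (dist h k)\<^sup>2" for t
      using dist_bounded[of h t k] power_mono[of "\<bar>apply_bcontfun h t - apply_bcontfun k t\<bar>" "dist h k" 2]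
      by (simp add: dist_real_def)
  qed simp
  then show ?thesis by (intro real_le_lsqrt) auto
qed

text \<open>One summand is changed at a time, with \<open>L2_add b h\<close> as the intermediate
  point.\<close>

lemma dist_L2_add: "dist (L2_add a h) (L2_add b k) \<le> dist a b + dist h k"
proof -
  have [measurable]: "apply_bcontfun c \<in> borel_measurable borel" for c :: C0_circle
    by (rule borel_measurable_continuous_onI) simp
  have "AE t in circle_measure. rep_L2 (L2_add a h) t - rep_L2 (L2_add b h) t = rep_L2 a t - rep_L2 b t"
    using rep_L2_add[of a h] rep_L2_add[of b h] by eventually_elim simp
  then have "dist (L2_add a h) (L2_add b h) = dist a b"
    by (subst dist_L2_cong_AE) (auto simp: dist_L2)
  moreover have "AE t in circle_measure. rep_L2 (L2_add b h) t - rep_L2 (L2_add b k) t = apply_bcontfun h t - apply_bcontfun k t"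
    using rep_L2_add[of b h] rep_L2_add[of b k] by eventually_elim simp
  then have "dist (L2_add b h) (L2_add b k) \<le> dist h k"
    using sqrt_integral_square_diff_le_dist[of h k] by (subst dist_L2_cong_AE) auto
  ultimately show ?thesis using dist_triangle[of "L2_add a h" "L2_add b k" "L2_add b h"] by simp
qed

lemma L2_add_tendsto:
  assumes "(\<lambda>n::nat. a n) \<longlonglongrightarrow> b" "(\<lambda>n. h n) \<longlonglongrightarrow> k"
  shows "(\<lambda>n. L2_add (a n) (h n)) \<longlonglongrightarrow> L2_add b k"
proof -
  have "(\<lambda>n. dist (a n) b) \<longlonglongrightarrow> 0" "(\<lambda>n. dist (h n) k) \<longlonglongrightarrow> 0"
    using assms by (simp_all add: tendsto_dist_iff[symmetric])
  from tendsto_add[OF this] have lim: "(\<lambda>n. dist (a n) b + dist (h n) k) \<longlonglongrightarrow> 0" by simp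
  have "(\<lambda>n. dist (L2_add (a n) (h n)) (L2_add b k)) \<longlonglongrightarrow> 0"
    by (rule tendsto_sandwich[OF _ _ tendsto_const lim]) (simp_all add: dist_L2_add)
  then show ?thesis by (simp add: tendsto_dist_iff[symmetric])
qed

definition C0_to_L2 :: "C0_circle \<Rightarrow> L2_circle" where
  "C0_to_L2 u = to_L2 (apply_bcontfun u)"

lemma rep_C0_to_L2: "AE t in circle_measure. rep_L2 (C0_to_L2 u) t = apply_bcontfun u t"
  unfolding C0_to_L2_def by (intro rep_to_L2 square_integrable_continuous) simp

lemma C0_to_L2_tendsto:
  assumes "(\<lambda>n::nat. u n) \<longlonglongrightarrow> v"
  shows "(\<lambda>n. C0_to_L2 (u n)) \<longlonglongrightarrow> C0_to_L2 v"
proof -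
  \<comment> \<open>Writing the embedding as a sum with the zero class reduces its continuity to
    that of \<open>L2_add\<close>.\<close>
  have eq: "C0_to_L2 w = L2_add (C0_to_L2 0) w" for w
  proof (rule L2_eqI)
    show "AE t in circle_measure. rep_L2 (C0_to_L2 w) t = rep_L2 (L2_add (C0_to_L2 0) w) t"
      using rep_C0_to_L2[of w] rep_C0_to_L2[of 0] rep_L2_add[of "C0_to_L2 0" w]
      by eventually_elim simp
  qed
  show ?thesis
    using L2_add_tendsto[OF tendsto_const assms, of "C0_to_L2 0"] unfolding eq[symmetric] .
qed

section \<open>The Sobolev space\<close>

lemma has_weak_derivativeD:
  assumes "has_weak_derivative a b" "smooth_on_circle \<phi>" "has_circle_derivative \<phi> \<phi>'"
  shows "(LINT t|circle_measure. rep_L2 a t * \<phi>' t) = - (LINT t|circle_measure. rep_L2 b t * \<phi> t)"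
  using assms unfolding has_weak_derivative_def by blast

text \<open>The derivative of a periodic function is periodic, so it descends to the circle. Thus
  every smooth function is available for testing a weak derivative.\<close>

lemma smooth_has_circle_derivative:
  assumes "smooth_on_circle h"
  obtains h' where "has_circle_derivative h h'"
proof -
  define p where "p s = h (to_circle s)" for s
  have "Ck_map (Suc 0) p"
    using assms by (simp only: smooth_on_circle_def smooth_map_def p_def[abs_def])
  then obtain p' where p': "\<And>s. (p has_real_derivative p' s) (at s)"
    unfolding Ck_map_Suc_iff by auto
  have "p' (rep_circle (to_circle s)) = p' s" for s
  proof -
    have "to_circle (rep_circle (to_circle s)) = to_circle s"
      by (metis Quotient3_abs_rep Quotient3_circle)
    then obtain n where "rep_circle (to_circle s) - s = of_int n"
      by (auto simp: to_circle_eq_iff elim: Ints_cases)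
    then have n: "rep_circle (to_circle s) = s + of_int n" by simp
    have "((\<lambda>x. p (x + of_int n)) has_real_derivative p' (s + of_int n)) (at s)"
      using p'[of "s + of_int n"] DERIV_shift[of p "p' (s + of_int n)" s "of_int n"] by simp
    then have "(p has_real_derivative p' (s + of_int n)) (at s)"
      by (simp add: p_def[abs_def] to_circle_add_int)
    then show ?thesis unfolding n using p'[of s] DERIV_unique by blast
  qed
  then have "has_circle_derivative h (\<lambda>t. p' (rep_circle t))"
    using p' by (simp add: has_circle_derivative_def p_def[abs_def])
  then show thesis by (rule that)
qed

text \<open>The difference of two weak derivatives is orthogonal to all smooth functions. As
  \<open>H1_deriv\<close> is an arbitrary choice, this is what identifies it with a weak derivative
  found by other means.\<close>

lemma weak_derivative_unique:
  assumes "has_weak_derivative a b" "has_weak_derivative a c"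
  shows "b = c"
proof (rule L2_eqI)
  note i = square_integrable_imp_integrable[OF square_integrable_rep_L2]
  have "AE t in circle_measure. rep_L2 b t - rep_L2 c t = 0"
  proof (rule smooth_orthogonal_imp_zero)
    show "integrable circle_measure (\<lambda>t. rep_L2 b t - rep_L2 c t)" using i by simp
    fix \<psi> assume \<psi>: "smooth_on_circle \<psi>"
    then obtain \<psi>' where \<psi>': "has_circle_derivative \<psi> \<psi>'" by (rule smooth_has_circle_derivative)
    note m = integrable_mult_continuous[OF i smooth_on_circle_continuous[OF \<psi>]]
    show "(LINT t|circle_measure. (rep_L2 b t - rep_L2 c t) * \<psi> t) = 0"
      unfolding left_diff_distrib
      using m[of b] m[of c] has_weak_derivativeD[OF assms(1) \<psi> \<psi>'] has_weak_derivativeD[OF assms(2) \<psi> \<psi>'] by simp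
  qed
  then show "AE t in circle_measure. rep_L2 b t = rep_L2 c t" by simp
qed

lemma integral_rep_L2_mult_tendsto:
  assumes a: "(\<lambda>n::nat. a n) \<longlonglongrightarrow> b" and g: "continuous_on UNIV g"
  shows "(\<lambda>n. LINT t|circle_measure. rep_L2 (a n) t * g t) \<longlonglongrightarrow> (LINT t|circle_measure. rep_L2 b t * g t)"
proof -
  obtain B where B: "\<And>t. \<bar>g t\<bar> \<le> B" using continuous_circle_bounded[OF g] by blast
  note i = square_integrable_imp_integrable[OF square_integrable_rep_L2]
  note m = integrable_mult_continuous[OF i g]
  have B0: "0 \<le> B" using B abs_ge_zero order_trans by blast
  have lim: "(\<lambda>n. dist (a n) b * B) \<longlonglongrightarrow> 0"
    using a by (intro tendsto_mult_left_zero) (simp add: tendsto_dist_iff[symmetric])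
  have le: "dist (LINT t|circle_measure. rep_L2 (a n) t * g t) (LINT t|circle_measure. rep_L2 b t * g t) \<le> dist (a n) b * B" for n
  proof -
    have "dist (LINT t|circle_measure. rep_L2 (a n) t * g t) (LINT t|circle_measure. rep_L2 b t * g t)
        = \<bar>LINT t|circle_measure. rep_L2 (a n) t * g t - rep_L2 b t * g t\<bar>"
      using m[of "a n"] m[of b] by (simp add: dist_real_def)
    also have "\<dots> \<le> (LINT t|circle_measure. \<bar>rep_L2 (a n) t * g t - rep_L2 b t * g t\<bar>)"
      by (rule integral_abs_bound)
    also have "\<dots> \<le> (LINT t|circle_measure. \<bar>rep_L2 (a n) t - rep_L2 b t\<bar> * B)"
    proof (rule integral_mono)
      show "integrable circle_measure (\<lambda>t. \<bar>rep_L2 (a n) t * g t - rep_L2 b t * g t\<bar>)"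
        using m[of "a n"] m[of b] by simp
      show "integrable circle_measure (\<lambda>t. \<bar>rep_L2 (a n) t - rep_L2 b t\<bar> * B)"
        using i[of "a n"] i[of b] by simp
      show "\<bar>rep_L2 (a n) t * g t - rep_L2 b t * g t\<bar> \<le> \<bar>rep_L2 (a n) t - rep_L2 b t\<bar> * B" for t
        unfolding left_diff_distrib[symmetric] abs_mult by (intro mult_left_mono B) simp
    qed
    also have "\<dots> = (LINT t|circle_measure. \<bar>rep_L2 (a n) t - rep_L2 b t\<bar>) * B" by simp
    also have "\<dots> \<le> dist (a n) b * B" by (intro mult_right_mono L1_le_dist_L2 B0)
    finally show ?thesis .
  qed
  have "(\<lambda>n. dist (LINT t|circle_measure. rep_L2 (a n) t * g t) (LINT t|circle_measure. rep_L2 b t * g t)) \<longlonglongrightarrow> 0"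
    by (rule tendsto_sandwich[OF _ _ tendsto_const lim]) (simp_all add: le)
  then show ?thesis by (subst tendsto_dist_iff)
qed

text \<open>Both sides of the identity that defines the weak derivative are continuous under L^2
  convergence, for each fixed test function.\<close>

lemma H1_closed:
  assumes u: "(\<lambda>n::nat. H1_to_L2 (u n)) \<longlonglongrightarrow> a" and u': "(\<lambda>n. H1_deriv (u n)) \<longlonglongrightarrow> b"
  obtains w where "H1_to_L2 w = a" "H1_deriv w = b"
proof -
  have weak: "has_weak_derivative a b"
    unfolding has_weak_derivative_def
  proof (intro allI impI)
    fix \<phi> \<phi>' assume \<phi>: "smooth_on_circle \<phi>" "has_circle_derivative \<phi> \<phi>'"
    have "(\<lambda>n. LINT t|circle_measure. rep_L2 (H1_to_L2 (u n)) t * \<phi>' t)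
        \<longlonglongrightarrow> (LINT t|circle_measure. rep_L2 a t * \<phi>' t)"
      by (rule integral_rep_L2_mult_tendsto[OF u smooth_on_circle_derivative_continuous[OF \<phi>]])
    moreover have "(\<lambda>n. - (LINT t|circle_measure. rep_L2 (H1_deriv (u n)) t * \<phi> t))
        \<longlonglongrightarrow> - (LINT t|circle_measure. rep_L2 b t * \<phi> t)"
      by (rule tendsto_minus[OF integral_rep_L2_mult_tendsto[OF u' smooth_on_circle_continuous[OF \<phi>(1)]]])
    ultimately show "(LINT t|circle_measure. rep_L2 a t * \<phi>' t) = - (LINT t|circle_measure. rep_L2 b t * \<phi> t)"
      unfolding has_weak_derivativeD[OF has_weak_derivative_H1_deriv \<phi>] by (rule LIMSEQ_unique)
  qed
  then have w: "H1_to_L2 (Abs_H1_circle a) = a"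
    by (intro Abs_H1_circle_inverse) auto
  have "H1_deriv (Abs_H1_circle a) = b"
    using weak_derivative_unique[OF _ weak] has_weak_derivative_H1_deriv[of "Abs_H1_circle a"] unfolding w by blast
  with w show thesis by (rule that)
qed

lemma H1_tendsto_iff:
  fixes u :: "nat \<Rightarrow> H1_circle"
  shows "u \<longlonglongrightarrow> v \<longleftrightarrow> (\<lambda>n. H1_to_L2 (u n)) \<longlonglongrightarrow> H1_to_L2 v \<and> (\<lambda>n. H1_deriv (u n)) \<longlonglongrightarrow> H1_deriv v"
proof
  assume "u \<longlonglongrightarrow> v"
  then have lim: "(\<lambda>n. dist (u n) v) \<longlonglongrightarrow> 0" by (simp add: tendsto_dist_iff[symmetric])
  have "(\<lambda>n. dist (H1_to_L2 (u n)) (H1_to_L2 v)) \<longlonglongrightarrow> 0"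
    by (rule tendsto_sandwich[OF _ _ tendsto_const lim]) (simp_all add: dist_H1_circle_def real_le_rsqrt)
  moreover have "(\<lambda>n. dist (H1_deriv (u n)) (H1_deriv v)) \<longlonglongrightarrow> 0"
    by (rule tendsto_sandwich[OF _ _ tendsto_const lim]) (simp_all add: dist_H1_circle_def real_le_rsqrt)
  ultimately show "(\<lambda>n. H1_to_L2 (u n)) \<longlonglongrightarrow> H1_to_L2 v \<and> (\<lambda>n. H1_deriv (u n)) \<longlonglongrightarrow> H1_deriv v"
    by (simp add: tendsto_dist_iff[symmetric])
next
  assume "(\<lambda>n. H1_to_L2 (u n)) \<longlonglongrightarrow> H1_to_L2 v \<and> (\<lambda>n. H1_deriv (u n)) \<longlonglongrightarrow> H1_deriv v"
  then have "(\<lambda>n. dist (H1_to_L2 (u n)) (H1_to_L2 v)) \<longlonglongrightarrow> 0" "(\<lambda>n. dist (H1_deriv (u n)) (H1_deriv v)) \<longlonglongrightarrow> 0"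
    by (simp_all add: tendsto_dist_iff[symmetric])
  then have "(\<lambda>n. sqrt ((dist (H1_to_L2 (u n)) (H1_to_L2 v))\<^sup>2 + (dist (H1_deriv (u n)) (H1_deriv v))\<^sup>2)) \<longlonglongrightarrow> sqrt (0\<^sup>2 + 0\<^sup>2)"
    by (intro tendsto_intros)
  then have "(\<lambda>n. dist (u n) v) \<longlonglongrightarrow> 0" by (simp add: dist_H1_circle_def)
  then show "u \<longlonglongrightarrow> v" by (simp add: tendsto_dist_iff[symmetric])
qed

section \<open>The Sobolev embedding of H^1 into C^0\<close>

definition H1_to_C0 :: "H1_circle \<Rightarrow> C0_circle" where
  "H1_to_C0 u = (SOME w. (AE t in circle_measure. rep_L2 (H1_to_L2 u) t = apply_bcontfun w t) \<and>
     circle_primitive w (rep_L2 (H1_deriv u)))"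

lemma
  shows rep_H1_to_C0: "AE t in circle_measure. rep_L2 (H1_to_L2 u) t = apply_bcontfun (H1_to_C0 u) t"
    and circle_primitive_H1: "circle_primitive (H1_to_C0 u) (rep_L2 (H1_deriv u))"
proof -
  have "\<exists>w. (AE t in circle_measure. rep_L2 (H1_to_L2 u) t = apply_bcontfun w t) \<and>
     circle_primitive w (rep_L2 (H1_deriv u))"
    using weak_derivative_imp_primitive[OF square_integrable_rep_L2 square_integrable_rep_L2
        has_weak_derivativeD[OF has_weak_derivative_H1_deriv[of u]]] by blast
  from someI_ex[OF this]
  show "AE t in circle_measure. rep_L2 (H1_to_L2 u) t = apply_bcontfun (H1_to_C0 u) t"
    "circle_primitive (H1_to_C0 u) (rep_L2 (H1_deriv u))"
    by (simp_all add: H1_to_C0_def)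
qed

lemma C0_to_L2_H1: "C0_to_L2 (H1_to_C0 u) = H1_to_L2 u"
proof (rule L2_eqI)
  show "AE t in circle_measure. rep_L2 (C0_to_L2 (H1_to_C0 u)) t = rep_L2 (H1_to_L2 u) t"
    using rep_C0_to_L2[of "H1_to_C0 u"] rep_H1_to_C0[of u] by eventually_elim simp
qed

text \<open>A Sobolev inequality. The oscillation of the difference \<open>p\<close> is at most the
  L^1 norm of the difference of the derivatives, and some value of \<open>p\<close> is no larger
  than its L^1 mean.\<close>

lemma dist_H1_to_C0_le:
  "dist (H1_to_C0 u) (H1_to_C0 v) \<le> dist (H1_to_L2 u) (H1_to_L2 v) + dist (H1_deriv u) (H1_deriv v)"
proof (rule dist_bound)
  fix t
  define p where "p t = apply_bcontfun (H1_to_C0 u) t - apply_bcontfun (H1_to_C0 v) t" for t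
  define D where "D = dist (H1_deriv u) (H1_deriv v)"
  note i = square_integrable_imp_integrable[OF square_integrable_rep_L2]
  have pc: "continuous_on UNIV p" unfolding p_def by (intro continuous_intros) auto
  have osc: "\<bar>p (to_circle b) - p (to_circle a)\<bar> \<le> D" if "0 \<le> a" "a \<le> b" "b \<le> 1" for a b
  proof -
    have "p (to_circle b) - p (to_circle a) = integral {a..b} (\<lambda>s. rep_L2 (H1_deriv u) (to_circle s))
        - integral {a..b} (\<lambda>s. rep_L2 (H1_deriv v) (to_circle s))"
      using circle_primitive_H1[of u] circle_primitive_H1[of v] that
      unfolding circle_primitive_def p_def by smt
    also have "\<bar>\<dots>\<bar> \<le> (LINT t|circle_measure. \<bar>rep_L2 (H1_deriv u) t - rep_L2 (H1_deriv v) t\<bar>)"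
      by (rule circle_integral_diff_le[OF i i that(1,3)])
    also have "\<dots> \<le> D" unfolding D_def by (rule L1_le_dist_L2)
    finally show ?thesis .
  qed
  have "\<bar>p t\<bar> - D \<le> \<bar>p t'\<bar>" for t'
  proof -
    obtain a b where "a \<in> {0..<1}" "t = to_circle a" "b \<in> {0..<1}" "t' = to_circle b"
      by (meson to_circle_unit_interval)
    then have "\<bar>p t' - p t\<bar> \<le> D"
      using osc[of a b] osc[of b a] by (cases "a \<le> b") (auto simp: abs_minus_commute)
    then show ?thesis by linarith
  qed
  \<comment> \<open>Averaging over \<open>t'\<close> with total mass 1 keeps the left-hand side and
    replaces the right-hand side by the L^1 norm of \<open>p\<close>.\<close>
  then have "(LINT t'|circle_measure. \<bar>p t\<bar> - D) \<le> (LINT t'|circle_measure. \<bar>p t'\<bar>)"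
    by (intro integral_mono integrable_continuous_circle continuous_intros pc) auto
  also have "\<dots> = (LINT t|circle_measure. \<bar>rep_L2 (H1_to_L2 u) t - rep_L2 (H1_to_L2 v) t\<bar>)"
  proof (rule integral_cong_AE)
    show "AE t in circle_measure. \<bar>p t\<bar> = \<bar>rep_L2 (H1_to_L2 u) t - rep_L2 (H1_to_L2 v) t\<bar>"
      using rep_H1_to_C0[of u] rep_H1_to_C0[of v] by eventually_elim (simp add: p_def)
    have [measurable]: "p \<in> borel_measurable borel" by (rule borel_measurable_continuous_onI[OF pc])
    show "(\<lambda>t. \<bar>p t\<bar>) \<in> borel_measurable circle_measure" by simp
  qed simp
  also have "\<dots> \<le> dist (H1_to_L2 u) (H1_to_L2 v)" by (rule L1_le_dist_L2)
  finally show "dist (apply_bcontfun (H1_to_C0 u) t) (apply_bcontfun (H1_to_C0 v) t)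
      \<le> dist (H1_to_L2 u) (H1_to_L2 v) + dist (H1_deriv u) (H1_deriv v)"
    by (simp add: dist_real_def p_def D_def)
qed

lemma H1_to_C0_tendsto:
  assumes "u \<longlonglongrightarrow> v"
  shows "(\<lambda>n::nat. H1_to_C0 (u n)) \<longlonglongrightarrow> H1_to_C0 v"
proof -
  have "(\<lambda>n. dist (H1_to_L2 (u n)) (H1_to_L2 v)) \<longlonglongrightarrow> 0" "(\<lambda>n. dist (H1_deriv (u n)) (H1_deriv v)) \<longlonglongrightarrow> 0"
    using assms by (simp_all add: H1_tendsto_iff tendsto_dist_iff[symmetric])
  from tendsto_add[OF this]
  have lim: "(\<lambda>n. dist (H1_to_L2 (u n)) (H1_to_L2 v) + dist (H1_deriv (u n)) (H1_deriv v)) \<longlonglongrightarrow> 0" by simp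
  have "(\<lambda>n. dist (H1_to_C0 (u n)) (H1_to_C0 v)) \<longlonglongrightarrow> 0"
    by (rule tendsto_sandwich[OF _ _ tendsto_const lim]) (simp_all add: dist_H1_to_C0_le)
  then show ?thesis by (simp add: tendsto_dist_iff[symmetric])
qed

text \<open>Identities between elements of L^2 hold only almost everywhere, and the L^1 distance of
  such representatives is zero.\<close>

lemma circle_primitive_cong_AE:
  assumes w: "circle_primitive w v" and v: "integrable circle_measure v" and v': "integrable circle_measure v'"
    and ae: "AE t in circle_measure. v t = v' t"
  shows "circle_primitive w v'"
  unfolding circle_primitive_def
proof (intro conjI allI impI)
  show "(\<lambda>s. v' (to_circle s)) absolutely_integrable_on {0..1}" by (rule circle_absolutely_integrable[OF v'])
  fix a b :: real assume ab: "0 \<le> a" "a \<le> b" "b \<le> 1"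
  have "(LINT t|circle_measure. \<bar>v t - v' t\<bar>) = 0"
    by (rule integral_eq_zero_AE) (use ae in auto)
  then have "integral {a..b} (\<lambda>s. v (to_circle s)) = integral {a..b} (\<lambda>s. v' (to_circle s))"
    using circle_integral_diff_le[OF v v' ab(1,3)] by simp
  then show "apply_bcontfun w (to_circle b) - apply_bcontfun w (to_circle a) = integral {a..b} (\<lambda>s. v' (to_circle s))"
    using w ab by (simp add: circle_primitive_def)
qed

section \<open>The operator on the Sobolev space\<close>

text \<open>Replacing \<open>rep_L2 (H1_to_L2 u)\<close> by the continuous representative alters the
  integrand on a null set only. The nonlinear term then becomes a continuous function on the
  circle.\<close>

lemma
  assumes f: "continuous_on UNIV f"
  shows square_integrable_F_H: "square_integrable (\<lambda>t. rep_L2 (H1_deriv u) t + f (t, rep_L2 (H1_to_L2 u) t))"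
    and F_H_eq: "F_H f u = L2_add (H1_deriv u) (superposition f (H1_to_C0 u))"
proof -
  let ?v = "\<lambda>t. rep_L2 (H1_deriv u) t + f (t, rep_L2 (H1_to_L2 u) t)"
  let ?w = "\<lambda>t. rep_L2 (H1_deriv u) t + apply_bcontfun (superposition f (H1_to_C0 u)) t"
  have [measurable]: "f \<in> borel_measurable borel" by (rule borel_measurable_continuous_onI[OF f])
  have m: "?v \<in> borel_measurable circle_measure" by simp
  have w: "square_integrable ?w"
    by (intro square_integrable_add_continuous square_integrable_rep_L2)
  have ae: "AE t in circle_measure. ?w t = ?v t"
    using rep_H1_to_C0[of u] by eventually_elim (simp add: apply_superposition[OF f])
  have "integrable circle_measure (\<lambda>t. (?w t)\<^sup>2) \<longleftrightarrow> integrable circle_measure (\<lambda>t. (?v t)\<^sup>2)"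
    using ae w m by (intro integrable_cong_AE) (auto simp: square_integrable_def)
  then show v: "square_integrable ?v"
    using w m by (simp add: square_integrable_def)
  have "L2_rel ?v ?w"
    using v w ae by (auto simp: L2_rel_def)
  then show "F_H f u = L2_add (H1_deriv u) (superposition f (H1_to_C0 u))"
    unfolding F_H_def L2_add_def by (rule Quotient3_rel_abs[OF Quotient3_L2_circle])
qed

text \<open>The scheme of \<open>proper_F_C\<close>, with continuous representatives in the
  compactness step and L^2 limits of the derivatives in the conclusion.\<close>

lemma proper_F_H:
  assumes f: "proper f"
  shows "proper (F_H f)"
proof (rule proper_sequentialI)
  have fc: "continuous_on UNIV f" using f by (simp add: proper_def)
  note eq = F_H_eq[OF fc]
  show "(\<lambda>n. F_H f (x n)) \<longlonglongrightarrow> F_H f l" if "x \<longlonglongrightarrow> l" for x :: "nat \<Rightarrow> H1_circle" and l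
    unfolding eq using that
    by (intro L2_add_tendsto superposition_tendsto fc H1_to_C0_tendsto) (simp_all add: H1_tendsto_iff)
  fix x :: "nat \<Rightarrow> H1_circle" and y
  assume y: "(\<lambda>n. F_H f (x n)) \<longlonglongrightarrow> y"
  have ae: "AE t in circle_measure. rep_L2 (H1_deriv u) t
      = rep_L2 (F_H f u) t - f (t, apply_bcontfun (H1_to_C0 u) t)" for u
    using rep_L2_add[of "H1_deriv u" "superposition f (H1_to_C0 u)"] unfolding eq
    by eventually_elim (simp add: apply_superposition[OF fc])
  have deriv: "H1_deriv u = L2_add (F_H f u) (- superposition f (H1_to_C0 u))" for u
  proof (rule L2_eqI)
    show "AE t in circle_measure. rep_L2 (H1_deriv u) t = rep_L2 (L2_add (F_H f u) (- superposition f (H1_to_C0 u))) t"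
      using ae[of u] rep_L2_add[of "F_H f u" "- superposition f (H1_to_C0 u)"]
      by eventually_elim (simp add: uminus_bcontfun.rep_eq apply_superposition[OF fc])
  qed
  note i = square_integrable_imp_integrable[OF square_integrable_rep_L2]
  obtain k v where k: "strict_mono (k :: nat \<Rightarrow> nat)" and v: "((\<lambda>n. H1_to_C0 (x n)) \<circ> k) \<longlonglongrightarrow> v"
  proof (rule primitive_sequence_compact[OF f])
    show "circle_primitive (H1_to_C0 (x n)) (\<lambda>t. rep_L2 (F_H f (x n)) t - f (t, apply_bcontfun (H1_to_C0 (x n)) t))" for n
    proof (rule circle_primitive_cong_AE[OF circle_primitive_H1 i _ ae])
      have "integrable circle_measure (apply_bcontfun (superposition f (H1_to_C0 (x n))))"
        by (rule integrable_continuous_circle) simp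
      moreover have "apply_bcontfun (superposition f (H1_to_C0 (x n))) = (\<lambda>t. f (t, apply_bcontfun (H1_to_C0 (x n)) t))"
        by (simp add: fun_eq_iff apply_superposition[OF fc])
      ultimately show "integrable circle_measure (\<lambda>t. rep_L2 (F_H f (x n)) t - f (t, apply_bcontfun (H1_to_C0 (x n)) t))"
        using i[of "F_H f (x n)"] by (simp only: Bochner_Integration.integrable_diff)
    qed
    have lim: "(\<lambda>n. dist (F_H f (x n)) y) \<longlonglongrightarrow> 0" using y by (simp add: tendsto_dist_iff[symmetric])
    show "(\<lambda>n. LINT t|circle_measure. \<bar>rep_L2 (F_H f (x n)) t - rep_L2 y t\<bar>) \<longlonglongrightarrow> 0"
      by (rule tendsto_sandwich[OF _ _ tendsto_const lim]) (simp_all add: L1_le_dist_L2)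
  qed (auto intro: i)
  have v': "(\<lambda>n. H1_to_C0 (x (k n))) \<longlonglongrightarrow> v" using v by (simp add: o_def)
  \<comment> \<open>Uniform convergence of the continuous representatives implies convergence of
    their classes in L^2.\<close>
  have L: "(\<lambda>n. H1_to_L2 (x (k n))) \<longlonglongrightarrow> C0_to_L2 v"
    unfolding C0_to_L2_H1[symmetric] by (rule C0_to_L2_tendsto[OF v'])
  have "(\<lambda>n. F_H f (x (k n))) \<longlonglongrightarrow> y" using LIMSEQ_subseq_LIMSEQ[OF y k] by (simp add: o_def)
  then have D: "(\<lambda>n. H1_deriv (x (k n))) \<longlonglongrightarrow> L2_add y (- superposition f v)"
    unfolding deriv by (intro L2_add_tendsto tendsto_minus superposition_tendsto fc v')
  obtain w where "H1_to_L2 w = C0_to_L2 v" "H1_deriv w = L2_add y (- superposition f v)"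
    using H1_closed[OF L D] by blast
  then have "(x \<circ> k) \<longlonglongrightarrow> w" using L D by (simp add: H1_tendsto_iff)
  then show "\<exists>k l. strict_mono k \<and> (x \<circ> k) \<longlonglongrightarrow> l" using k by blast
qed

text \<open>The membership claims accompany properness because \<open>to_L2\<close> and
  \<open>Bcontfun\<close> are meaningful only on square integrable and on bounded continuous
  functions; they certify that \<open>F_H\<close> and \<open>F_C\<close> are the intended
  operators.\<close>

theorem proposition1p4:
  fixes f :: "circle \<times> real \<Rightarrow> real"
  assumes "smooth_on_cylinder f"
    and "proper f"
  shows "((\<forall>u. square_integrable (\<lambda>t. rep_L2 (H1_deriv u) t + f (t, rep_L2 (H1_to_L2 u) t)))
           \<and> proper (F_H f))
       \<and> ((\<forall>u. (\<lambda>t. apply_bcontfun (C1_deriv u) t + f (t, apply_bcontfun (C1_to_C0 u) t)) \<in> bcontfun)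
           \<and> proper (F_C f))"
proof -
  have f: "continuous_on UNIV f" using assms(2) by (simp add: proper_def)
  have "(\<lambda>t. apply_bcontfun (C1_deriv u) t + f (t, apply_bcontfun (C1_to_C0 u) t)) \<in> bcontfun" for u
    using apply_bcontfun[of "C1_deriv u + superposition f (C1_to_C0 u)"]
    by (simp add: plus_bcontfun.rep_eq[abs_def] apply_superposition[OF f])
  then show ?thesis
    using square_integrable_F_H[OF f] proper_F_H[OF assms(2)] proper_F_C[OF assms(2)] by blast
qed

end
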